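(* Let $\mathcal E_*,\mathcal E,H$ be complex Hilbert spaces, $T\in L(H)^n$ a pure $m$-hypercontraction, and let $B\in L(\mathcal E_*,H^n)$, $C\in L(H,\mathcal E)$, $D\in L(\mathcal E_*,\mathcal E)$ be operators such that the matrix operator $\begin{pmatrix}T^*&B\\C&D\end{pmatrix}:H\oplus\mathcal E_*\to H^n\oplus\mathcal E$ satisfies (KI1) $C^*C=\Delta_T^{(m)}$; (KI2) $D^*C=-B^*\big(\oplus\sum_{k=0}^{m-1}\Delta_T^{(k)}\big)T^*$; (KI3) $D^*D+B^*\big(\oplus\sum_{k=0}^{m-1}\Delta_T^{(k)}\big)B=1_{\mathcal E_*}$; (KI4) $\operatorname{Im}(\oplus j_C)B\subset M_z^*H_m(\mathbb B,\mathcal E)$. Let $W:\mathbb B\to L(\mathcal E_*,\mathcal E)$ be given by $W(z)=D+C\sum_{k=1}^m(1_H-ZT^* )^{-k}ZB$. Then $W$ is a $K_m$-inner function.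
   Context: $\mathbb B=\{z\in\mathbb C^n:\|z\|<1\}$; $\rho_m(\alpha)=\frac{(m+|\alpha|-1)!}{\alpha!(m-1)!}$ for $\alpha\in\mathbb N^n$. $H_m(\mathbb B,\mathcal E)$ is the Hilbert space of analytic $f=\sum f_\alpha z^\alpha:\mathbb B\to\mathcal E$ with $\|f\|^2=\sum\|f_\alpha\|^2/\rho_m(\alpha)<\infty$ (reproducing kernel $K_m(z,w)=(1-\langle z,w\rangle)^{-m}1_{\mathcal E}$). $M_z=(M_{z_1},\dots,M_{z_n})$ is the tuple of coordinate multiplications, $M_z^\alpha=\prod M_{z_i}^{\alpha_i}$, and $M_z^*$ is the column $f\mapsto(M_{z_i}^*f)_i$. For commuting $T\in L(H)^n$: $\sigma_T(X)=\sum T_iXT_i^*$, $\Delta_T^{(k)}=(1-\sigma_T)^k(1_H)$; $m$-hypercontraction: $\Delta_T^{(1)}\ge0,\Delta_T^{(m)}\ge0$; pure: $\sigma_T^k(1_H)\to0$ strongly. $T^*:H\to H^n$ is the column $h\mapsto(T_i^*h)_i$; for $z\in\mathbb B$, $Z:H^n\to H$, $(h_i)\mapsto\sum z_ih_i$; $T^{*\alpha}=(\prod T_i^{\alpha_i})^*$; $\oplus X$ denotes $X$ acting componentwise on $n$-tuples. $j_C:H\to H_m(\mathbb B,\mathcal E)$ is $j_Cx=\sum_\alpha\rho_m(\alpha)(CT^{*\alpha}x)z^\alpha=C(1_H-ZT^* )^{-m}x$ (under (KI1) a well-defined isometry). A $K_m$-inner function is an analytic $W:\mathbb B\to L(\mathcal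 E_*,\mathcal E)$ such that for every $x\in\mathcal E_*$ the function $Wx:z\mapsto W(z)x$ lies in $H_m(\mathbb B,\mathcal E)$ with $\|Wx\|=\|x\|$, and $W\mathcal E_*\perp M_z^\alpha(W\mathcal E_* )$ for all $\alpha\in\mathbb N^n\setminus\{0\}$. *)

theory Defs
  imports "HOL-Analysis.Analysis"
begin

section \<open>Complex Hilbert spaces\<close>

text \<open>HOL-Analysis has no complex inner product spaces, so we introduce a type class:
a real normed vector space with a compatible complex scalar multiplication and a
complex inner product (linear in the first argument) inducing the norm; a complex
Hilbert space is such a space that is complete.\<close>

class complex_inner = real_normed_vector +
  fixes scaleC :: "complex \<Rightarrow> 'a \<Rightarrow> 'a"
    and cinner :: "'a \<Rightarrow> 'a \<Rightarrow> complex"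
  assumes scaleC_add_right: "scaleC a (x + y) = scaleC a x + scaleC a y"
    and scaleC_add_left: "scaleC (a + b) x = scaleC a x + scaleC b x"
    and scaleC_scaleC: "scaleC a (scaleC b x) = scaleC (a * b) x"
    and scaleC_one: "scaleC 1 x = x"
    and scaleR_scaleC: "scaleR r x = scaleC (complex_of_real r) x"
    and cinner_commute: "cinner x y = cnj (cinner y x)"
    and cinner_add_left: "cinner (x + y) z = cinner x z + cinner y z"
    and cinner_scaleC_left: "cinner (scaleC a x) y = a * cinner x y"
    and cinner_self_Re_nonneg: "0 \<le> Re (cinner x x)"
    and norm_eq_sqrt_cinner: "norm x = sqrt (Re (cinner x x))"

class chilbert_space = complex_inner + complete_space

text \<open>The complex numbers form a complex Hilbert space (so the class is not vacuous).\<close>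

instantiation complex :: chilbert_space
begin
definition scaleC_complex :: "complex \<Rightarrow> complex \<Rightarrow> complex" where
  "scaleC_complex a x = a * x"
definition cinner_complex :: "complex \<Rightarrow> complex \<Rightarrow> complex" where
  "cinner_complex x y = x * cnj y"
instance
proof
  fix x y z a b :: complex and r :: real
  show "scaleC a (x + y) = scaleC a x + scaleC a y" by (simp add: scaleC_complex_def algebra_simps)
  show "scaleC (a + b) x = scaleC a x + scaleC b x" by (simp add: scaleC_complex_def algebra_simps)
  show "scaleC a (scaleC b x) = scaleC (a * b) x" by (simp add: scaleC_complex_def)
  show "scaleC 1 x = x" by (simp add: scaleC_complex_def)
  show "scaleR r x = scaleC (complex_of_real r) x" by (simp add: scaleC_complex_def scaleR_conv_of_real)
  show "cinner x y = cnj (cinner y x)" by (simp add: cinner_complex_def mult.commute)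
  show "cinner (x + y) z = cinner x z + cinner y z" by (simp add: cinner_complex_def algebra_simps)
  show "cinner (scaleC a x) y = a * cinner x y" by (simp add: cinner_complex_def scaleC_complex_def)
  show "0 \<le> Re (cinner x x)" by (simp add: cinner_complex_def complex_mult_cnj)
  show "norm x = sqrt (Re (cinner x x))"
    by (simp add: cinner_complex_def complex_mult_cnj cmod_def power2_eq_square)
qed
end

section \<open>Operators\<close>

definition clinear :: "('a::complex_inner \<Rightarrow> 'b::complex_inner) \<Rightarrow> bool" where
  "clinear A \<longleftrightarrow> (\<forall>x y. A (x + y) = A x + A y) \<and> (\<forall>a x. A (scaleC a x) = scaleC a (A x))"

definition cbounded_linear :: "('a::complex_inner \<Rightarrow> 'b::complex_inner) \<Rightarrow> bool" where
  "cbounded_linear A \<longleftrightarrow> clinear A \<and> (\<exists>K. \<forall>x. norm (A x) \<le> K * norm x)"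

text \<open>A' is the Hilbert-space adjoint of A.\<close>
definition is_adjoint :: "('a::complex_inner \<Rightarrow> 'b::complex_inner) \<Rightarrow> ('b \<Rightarrow> 'a) \<Rightarrow> bool" where
  "is_adjoint A A' \<longleftrightarrow> (\<forall>x y. cinner (A x) y = cinner x (A' y))"

text \<open>Positivity of an operator on a complex Hilbert space.\<close>
definition pos_op :: "('a::complex_inner \<Rightarrow> 'a) \<Rightarrow> bool" where
  "pos_op P \<longleftrightarrow> (\<forall>h. Im (cinner (P h) h) = 0 \<and> 0 \<le> Re (cinner (P h) h))"

text \<open>Tuples T = (T_0,...,T_{n-1}) are functions on indices i < n; Ts i is the adjoint of T i.\<close>

definition sigmaT :: "nat \<Rightarrow> (nat \<Rightarrow> 'h \<Rightarrow> 'h) \<Rightarrow> (nat \<Rightarrow> 'h \<Rightarrow> 'h)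
    \<Rightarrow> ('h \<Rightarrow> 'h) \<Rightarrow> ('h::complex_inner \<Rightarrow> 'h)" where
  "sigmaT n T Ts X = (\<lambda>h. \<Sum>i<n. T i (X (Ts i h)))"

definition DeltaT :: "nat \<Rightarrow> (nat \<Rightarrow> 'h \<Rightarrow> 'h) \<Rightarrow> (nat \<Rightarrow> 'h \<Rightarrow> 'h)
    \<Rightarrow> nat \<Rightarrow> ('h::complex_inner \<Rightarrow> 'h)" where
  "DeltaT n T Ts k = ((\<lambda>X h. X h - sigmaT n T Ts X h) ^^ k) id"

text \<open>The operator sum_{k=0}^{m-1} Delta_T^{(k)}.\<close>
definition DeltaSum :: "nat \<Rightarrow> (nat \<Rightarrow> 'h \<Rightarrow> 'h) \<Rightarrow> (nat \<Rightarrow> 'h \<Rightarrow> 'h)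
    \<Rightarrow> nat \<Rightarrow> ('h::complex_inner \<Rightarrow> 'h)" where
  "DeltaSum n T Ts m = (\<lambda>h. \<Sum>k<m. DeltaT n T Ts k h)"

definition m_hypercontraction :: "nat \<Rightarrow> nat \<Rightarrow> (nat \<Rightarrow> 'h \<Rightarrow> 'h)
    \<Rightarrow> (nat \<Rightarrow> 'h::complex_inner \<Rightarrow> 'h) \<Rightarrow> bool" where
  "m_hypercontraction m n T Ts \<longleftrightarrow>
     pos_op (DeltaT n T Ts 1) \<and> pos_op (DeltaT n T Ts m)"

definition pure_tuple :: "nat \<Rightarrow> (nat \<Rightarrow> 'h \<Rightarrow> 'h) \<Rightarrow> (nat \<Rightarrow> 'h::complex_inner \<Rightarrow> 'h) \<Rightarrow> bool" where
  "pure_tuple n T Ts \<longleftrightarrow> (\<forall>h. (\<lambda>k. ((sigmaT n T Ts ^^ k) id) h) \<longlonglongrightarrow> 0)"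

text \<open>T^{*alpha} = (T_0^{alpha_0} ... T_{n-1}^{alpha_{n-1}})^* ; S is the tuple of adjoints.\<close>
primrec opmpow :: "nat \<Rightarrow> (nat \<Rightarrow> 'h \<Rightarrow> 'h) \<Rightarrow> (nat \<Rightarrow> nat) \<Rightarrow> 'h \<Rightarrow> 'h" where
  "opmpow 0 S \<alpha> = id"
| "opmpow (Suc k) S \<alpha> = (S k ^^ \<alpha> k) \<circ> opmpow k S \<alpha>"

section \<open>The spaces H_m(B, E)\<close>

text \<open>Points of C^n are functions z :: nat => complex, only z 0, ..., z (n-1) matter.
 Multi-indices are functions alpha :: nat => nat vanishing from n on.\<close>

definition ballN :: "nat \<Rightarrow> (nat \<Rightarrow> complex) set" where
  "ballN n = {z. (\<Sum>i<n. (cmod (z i))\<^sup>2) < 1}"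

definition multi_idx :: "nat \<Rightarrow> (nat \<Rightarrow> nat) set" where
  "multi_idx n = {\<alpha>. \<forall>i\<ge>n. \<alpha> i = 0}"

definition mpow :: "nat \<Rightarrow> (nat \<Rightarrow> complex) \<Rightarrow> (nat \<Rightarrow> nat) \<Rightarrow> complex" where
  "mpow n z \<alpha> = (\<Prod>i<n. z i ^ \<alpha> i)"

definition rho :: "nat \<Rightarrow> nat \<Rightarrow> (nat \<Rightarrow> nat) \<Rightarrow> real" where
  "rho m n \<alpha> = fact (m + (\<Sum>i<n. \<alpha> i) - 1) / ((\<Prod>i<n. fact (\<alpha> i)) * fact (m - 1))"

text \<open>c is the family of Taylor coefficients of f on the ball.\<close>
definition Hm_rep :: "nat \<Rightarrow> ((nat \<Rightarrow> nat) \<Rightarrow> 'e) \<Rightarrow> ((nat \<Rightarrow> complex) \<Rightarrow> 'e::chilbert_space) \<Rightarrow> bool" where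
  "Hm_rep n c f \<longleftrightarrow> (\<forall>z\<in>ballN n. ((\<lambda>\<alpha>. scaleC (mpow n z \<alpha>) (c \<alpha>)) has_sum f z) (multi_idx n))"

definition in_Hm :: "nat \<Rightarrow> nat \<Rightarrow> ((nat \<Rightarrow> complex) \<Rightarrow> 'e::chilbert_space) \<Rightarrow> bool" where
  "in_Hm m n f \<longleftrightarrow> (\<exists>c. Hm_rep n c f \<and>
      (\<lambda>\<alpha>. (norm (c \<alpha>))\<^sup>2 / rho m n \<alpha>) summable_on multi_idx n)"

definition Hm_coeff :: "nat \<Rightarrow> ((nat \<Rightarrow> complex) \<Rightarrow> 'e::chilbert_space) \<Rightarrow> (nat \<Rightarrow> nat) \<Rightarrow> 'e" where
  "Hm_coeff n f = (SOME c. Hm_rep n c f)"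

definition Hm_inner :: "nat \<Rightarrow> nat \<Rightarrow> ((nat \<Rightarrow> complex) \<Rightarrow> 'e::chilbert_space)
    \<Rightarrow> ((nat \<Rightarrow> complex) \<Rightarrow> 'e) \<Rightarrow> complex" where
  "Hm_inner m n f g = (\<Sum>\<^sub>\<infinity>\<alpha>\<in>multi_idx n.
      cinner (Hm_coeff n f \<alpha>) (Hm_coeff n g \<alpha>) / complex_of_real (rho m n \<alpha>))"

definition Hm_norm :: "nat \<Rightarrow> nat \<Rightarrow> ((nat \<Rightarrow> complex) \<Rightarrow> 'e::chilbert_space) \<Rightarrow> real" where
  "Hm_norm m n f = sqrt (Re (Hm_inner m n f f))"

text \<open>h = M_{z_i}^* f in H_m(B,E).\<close>
definition is_Mz_adj :: "nat \<Rightarrow> nat \<Rightarrow> nat \<Rightarrow> ((nat \<Rightarrow> complex) \<Rightarrow> 'e::chilbert_space)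
    \<Rightarrow> ((nat \<Rightarrow> complex) \<Rightarrow> 'e) \<Rightarrow> bool" where
  "is_Mz_adj m n i f h \<longleftrightarrow>
     (\<forall>g. in_Hm m n g \<longrightarrow> Hm_inner m n h g = Hm_inner m n f (\<lambda>z. scaleC (z i) (g z)))"

text \<open>j_C x = sum_alpha rho_m(alpha) (C T^{*alpha} x) z^alpha.\<close>
definition jC :: "nat \<Rightarrow> nat \<Rightarrow> ('h \<Rightarrow> 'e) \<Rightarrow> (nat \<Rightarrow> 'h \<Rightarrow> 'h) \<Rightarrow> 'h
    \<Rightarrow> (nat \<Rightarrow> complex) \<Rightarrow> 'e::chilbert_space" where
  "jC m n C Ts x = (\<lambda>z. \<Sum>\<^sub>\<infinity>\<alpha>\<in>multi_idx n.
      scaleC (complex_of_real (rho m n \<alpha>) * mpow n z \<alpha>) (C (opmpow n Ts \<alpha> x)))"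

section \<open>K_m-inner functions\<close>

definition Km_inner :: "nat \<Rightarrow> nat \<Rightarrow> ((nat \<Rightarrow> complex) \<Rightarrow> 'es::chilbert_space \<Rightarrow> 'e::chilbert_space) \<Rightarrow> bool" where
  "Km_inner m n W \<longleftrightarrow>
     (\<forall>z\<in>ballN n. cbounded_linear (W z)) \<and>
     (\<forall>x. in_Hm m n (\<lambda>z. W z x) \<and> Hm_norm m n (\<lambda>z. W z x) = norm x) \<and>
     (\<forall>x y \<alpha>. \<alpha> \<in> multi_idx n \<longrightarrow> \<alpha> \<noteq> (\<lambda>_. 0) \<longrightarrow>
        Hm_inner m n (\<lambda>z. W z x) (\<lambda>z. scaleC (mpow n z \<alpha>) (W z y)) = 0)"

text \<open>The transfer function W(z) = D + C sum_{k=1}^m (1 - Z T^*)^{-k} Z B.\<close>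
definition ZTs :: "nat \<Rightarrow> (nat \<Rightarrow> complex) \<Rightarrow> (nat \<Rightarrow> 'h \<Rightarrow> 'h) \<Rightarrow> 'h \<Rightarrow> 'h::chilbert_space" where
  "ZTs n z Ts h = (\<Sum>i<n. scaleC (z i) (Ts i h))"

definition Wtf :: "nat \<Rightarrow> nat \<Rightarrow> (nat \<Rightarrow> 'h::chilbert_space \<Rightarrow> 'h) \<Rightarrow> (nat \<Rightarrow> 'es \<Rightarrow> 'h) \<Rightarrow> ('h \<Rightarrow> 'e)
    \<Rightarrow> ('es \<Rightarrow> 'e) \<Rightarrow> (nat \<Rightarrow> complex) \<Rightarrow> 'es::chilbert_space \<Rightarrow> 'e::chilbert_space" where
  "Wtf m n Ts B C D z e = D e + C (\<Sum>k\<in>{1..m}.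
      ((inv (\<lambda>h::'h. h - ZTs n z Ts h)) ^^ k) (\<Sum>i<n. scaleC (z i) (B i e)))"

end

theory Submission
  imports Defs
begin

text \<open>
  Testing (KI4) against monomials shows that for \<open>\<beta> \<noteq> 0\<close> the vector
  \<open>g\<^sub>\<beta> = C T\<^sup>*\<^bsup>\<beta> - e\<^sub>i\<^esup> B\<^sub>i x\<close> does not depend on the index \<open>i\<close> with \<open>\<beta>\<^sub>i > 0\<close>. Together with
  \<open>\<Sum>\<^sub>i \<Sum>\<^sub>k\<^sub>\<le>\<^sub>m \<rho>\<^sub>k(\<beta> - e\<^sub>i) = \<rho>\<^sub>m(\<beta>)\<close> and \<open>(1 - ZT\<^sup>*)\<^sup>-\<^sup>k = \<Sum>\<^sub>\<alpha> \<rho>\<^sub>k(\<alpha>) z\<^sup>\<alpha> T\<^sup>*\<^sup>\<alpha>\<close> this makes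
  \<open>Dx\<close> and \<open>\<rho>\<^sub>m(\<beta>) g\<^sub>\<beta>\<close> the Taylor coefficients of \<open>Wx\<close>.

  Purity and positivity of \<open>\<Delta>\<^sup>(\<^sup>m\<^sup>)\<close> give \<open>\<Sum>\<^sub>\<alpha> \<rho>\<^sub>k(\<alpha>) T\<^sup>\<alpha> \<Delta>\<^sup>(\<^sup>m\<^sup>) T\<^sup>*\<^sup>\<alpha> = \<Delta>\<^sup>(\<^sup>m\<^sup>-\<^sup>k\<^sup>)\<close> weakly. By (KI1) and
  the same splitting of \<open>\<rho>\<^sub>m(\<beta>)\<close>, the sum \<open>\<Sum>\<^sub>\<beta> \<rho>\<^sub>m(\<beta>) \<langle>g\<^sub>\<beta>, g'\<^sub>\<beta>\<rangle>\<close> over \<open>\<beta> \<noteq> 0\<close> is equal to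
  \<open>\<Sum>\<^sub>i \<langle>\<Sum>\<^sub>k\<^sub><\<^sub>m \<Delta>\<^sup>(\<^sup>k\<^sup>) v\<^sub>i, v'\<^sub>i\<rangle>\<close> whenever \<open>g\<close> and \<open>g'\<close> arise in this way from tuples \<open>v\<close> and \<open>v'\<close>.
  With \<open>v = v' = Bx\<close> this and (KI3) give \<open>\<parallel>Wx\<parallel> = \<parallel>x\<parallel>\<close>; with \<open>v = T\<^sup>*u\<close> and \<open>v' = By\<close> this and
  (KI2) give the orthogonality.
\<close>

\<comment> \<open>Completeness enters through this instance: in a Banach space absolute summability
  gives unconditional summability, which is how the resolvent series below obtain their
  sums.\<close>
subclass (in chilbert_space) banach ..

section \<open>Complex inner product spaces\<close>

lemma scaleC_zero_left [simp]: "scaleC 0 (x::'a::complex_inner) = 0"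
  by (metis add_cancel_right_left scaleC_add_left)

lemma scaleC_zero_right [simp]: "scaleC a (0::'a::complex_inner) = 0"
  by (metis add_cancel_right_left scaleC_add_right)

lemma scaleC_minus_right: "scaleC a (- x) = - scaleC a (x::'a::complex_inner)"
  by (metis add.right_inverse add_eq_0_iff scaleC_add_right scaleC_zero_right)

lemma scaleC_diff_right: "scaleC a (x - y) = scaleC a x - scaleC a (y::'a::complex_inner)"
  by (metis diff_conv_add_uminus scaleC_add_right scaleC_minus_right)

lemma scaleC_diff_left: "scaleC (a - b) x = scaleC a x - scaleC b (x::'a::complex_inner)"
  by (metis add_diff_cancel diff_add_cancel scaleC_add_left)

lemma scaleC_sum_left: "scaleC (\<Sum>i\<in>A. f i) (x::'a::complex_inner) = (\<Sum>i\<in>A. scaleC (f i) x)"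
  by (induction A rule: infinite_finite_induct) (auto simp: scaleC_add_left)

lemma scaleC_sum_right: "scaleC a (\<Sum>i\<in>A. f i) = (\<Sum>i\<in>A. scaleC a (f i :: 'a::complex_inner))"
  by (induction A rule: infinite_finite_induct) (auto simp: scaleC_add_right)

lemma scaleR_scaleC_commute:
  "scaleC a (r *\<^sub>R x) = r *\<^sub>R scaleC a (x::'a::complex_inner)"
  by (simp add: scaleR_scaleC scaleC_scaleC mult.commute)

lemma cinner_add_right: "cinner x (y + z) = cinner x y + cinner x (z::'a::complex_inner)"
  by (metis cinner_add_left cinner_commute complex_cnj_add)

lemma cinner_scaleC_right: "cinner x (scaleC a y) = cnj a * cinner x (y::'a::complex_inner)"
  by (metis cinner_scaleC_left cinner_commute complex_cnj_mult)

lemma cinner_zero_left [simp]: "cinner 0 (y::'a::complex_inner) = 0"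
  by (metis cinner_scaleC_left mult_zero_left scaleC_zero_left)

lemma cinner_zero_right [simp]: "cinner (y::'a::complex_inner) 0 = 0"
  by (metis cinner_commute cinner_zero_left complex_cnj_zero)

lemma cinner_minus_left: "cinner (- x) y = - cinner x (y::'a::complex_inner)"
  by (metis add.right_inverse add_eq_0_iff cinner_add_left cinner_zero_left)

lemma cinner_diff_left: "cinner (x - y) z = cinner x z - cinner y (z::'a::complex_inner)"
  by (metis add_uminus_conv_diff cinner_add_left cinner_minus_left)

lemma cinner_diff_right: "cinner x (y - z) = cinner x y - cinner x (z::'a::complex_inner)"
  by (metis cinner_diff_left cinner_commute complex_cnj_diff)

lemma cinner_sum_left: "cinner (\<Sum>i\<in>A. f i) y = (\<Sum>i\<in>A. cinner (f i) (y::'a::complex_inner))"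
  by (induction A rule: infinite_finite_induct) (auto simp: cinner_add_left)

lemma cinner_self: "cinner x x = complex_of_real ((norm (x::'a::complex_inner))\<^sup>2)"
proof -
  have "Im (cinner x x) = 0"
    using arg_cong[OF cinner_commute[of x x], of Im] by simp
  then show ?thesis
    by (simp add: complex_eq_iff norm_eq_sqrt_cinner cinner_self_Re_nonneg)
qed

lemma norm_scaleC [simp]: "norm (scaleC a (x::'a::complex_inner)) = cmod a * norm x"
proof -
  have "complex_of_real ((norm (scaleC a x))\<^sup>2) = a * (cnj a * cinner x x)"
    unfolding cinner_self[symmetric] by (simp add: cinner_scaleC_left cinner_scaleC_right)
  also have "\<dots> = complex_of_real ((cmod a * norm x)\<^sup>2)"
    by (simp add: cinner_self mult.assoc[symmetric] complex_norm_square[symmetric] power_mult_distrib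
        del: of_real_power)
  finally have "(norm (scaleC a x))\<^sup>2 = (cmod a * norm x)\<^sup>2"
    using of_real_eq_iff by blast
  then show ?thesis by simp
qed

lemma cinner_Cauchy_Schwarz: "cmod (cinner x y) \<le> norm x * norm (y::'a::complex_inner)"
proof (cases "y = 0")
  case False
  \<comment> \<open>\<open>scaleC a y\<close> is the orthogonal projection of \<open>x\<close> onto
    the line through \<open>y\<close>; the inequality is the nonnegativity of the squared norm of
    what remains.\<close>
  define a where "a = cinner x y / complex_of_real ((norm y)\<^sup>2)"
  have ny: "norm y > 0" using False by simp
  have "complex_of_real ((norm (x - scaleC a y))\<^sup>2)
      = cinner x x - cnj a * cinner x y - a * cinner y x + a * cnj a * cinner y y"
    unfolding cinner_self[symmetric]
    by (simp add: cinner_diff_left cinner_diff_right cinner_scaleC_left cinner_scaleC_right algebra_simps)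
  also have "\<dots> = cinner x x - cnj a * cinner x y"
  proof -
    have "cnj a * cinner y y = cinner y x"
      using ny by (simp add: a_def cinner_self[of y] cinner_commute[of y x])
    then show ?thesis by (simp add: mult.assoc)
  qed
  also have "cnj a * cinner x y = complex_of_real ((cmod (cinner x y))\<^sup>2 / (norm y)\<^sup>2)"
    unfolding a_def by (simp add: complex_norm_square[symmetric] mult.commute del: of_real_power)
  finally have "(norm (x - scaleC a y))\<^sup>2 = (norm x)\<^sup>2 - (cmod (cinner x y))\<^sup>2 / (norm y)\<^sup>2"
    unfolding cinner_self[of x] of_real_diff[symmetric] of_real_eq_iff .
  then have "(cmod (cinner x y))\<^sup>2 / (norm y)\<^sup>2 \<le> (norm x)\<^sup>2"
    by (metis zero_le_power2 diff_ge_0_iff_ge)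
  then have "(cmod (cinner x y))\<^sup>2 \<le> (norm x * norm y)\<^sup>2"
    using ny by (simp add: divide_simps power_mult_distrib)
  then show ?thesis by (rule power2_le_imp_le) simp
qed simp

lemma cinner_eq_leftI:
  assumes "\<And>z. cinner x z = cinner y (z::'a::complex_inner)"
  shows "x = y"
proof -
  have "cinner (x - y) (x - y) = 0"
    using assms by (simp add: cinner_diff_left)
  then show ?thesis by (simp add: cinner_self)
qed

lemma cinner_eq_rightI:
  assumes "\<And>z. cinner z x = cinner z (y::'a::complex_inner)"
  shows "x = y"
  by (rule cinner_eq_leftI) (metis assms cinner_commute)

lemma bounded_linear_cinner_left: "bounded_linear (\<lambda>x. cinner x (y::'a::complex_inner))"
proof (rule bounded_linear_intro[where K = "norm y"])
  show "cinner (r *\<^sub>R x) y = r *\<^sub>R cinner x y" for r x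
    unfolding scaleR_scaleC[of r x] cinner_scaleC_left by (rule scaleR_conv_of_real[symmetric])
qed (auto simp: cinner_add_left intro: cinner_Cauchy_Schwarz)

lemma bounded_linear_scaleC: "bounded_linear (scaleC a :: 'a \<Rightarrow> 'a::complex_inner)"
  by (rule bounded_linear_intro[where K = "cmod a"])
    (auto simp: scaleC_add_right scaleR_scaleC_commute)

lemma clinear_bounded_linear:
  assumes "clinear A" "\<And>x. norm (A x) \<le> K * norm x"
  shows "bounded_linear A"
  using assms
  by (intro bounded_linear_intro[where K = K])
    (auto simp: clinear_def scaleR_scaleC mult.commute)

lemma cbounded_linear_bounded_linear: "cbounded_linear A \<Longrightarrow> bounded_linear A"
  using clinear_bounded_linear unfolding cbounded_linear_def by blast

lemma clinear_scaleC: "clinear A \<Longrightarrow> A (scaleC a x) = scaleC a (A x)"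
  by (simp add: clinear_def)

lemma clinear_add: "clinear A \<Longrightarrow> A (x + y) = A x + A y"
  by (simp add: clinear_def)

lemma clinear_0: "clinear A \<Longrightarrow> A 0 = 0"
  by (metis clinear_scaleC scaleC_zero_left)

lemma clinear_sum: "clinear A \<Longrightarrow> A (\<Sum>i\<in>I. f i) = (\<Sum>i\<in>I. A (f i))"
  by (induction I rule: infinite_finite_induct) (auto simp: clinear_add clinear_0)

text \<open>The inner product separates points, so the adjoint relation alone forces linearity of
  \<open>A'\<close>.\<close>

lemma is_adjoint_clinear:
  assumes "is_adjoint A A'"
  shows "clinear A'"
  unfolding clinear_def
proof (intro conjI allI)
  fix x y a
  have adj: "cinner z (A' w) = cinner (A z) w" for z w
    using assms by (simp add: is_adjoint_def)
  show "A' (x + y) = A' x + A' y"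
    by (rule cinner_eq_rightI) (simp add: adj cinner_add_right)
  show "A' (scaleC a x) = scaleC a (A' x)"
    by (rule cinner_eq_rightI) (simp add: adj cinner_scaleC_right)
qed

section \<open>Unconditional sums\<close>

lemma has_sum_eq_on:
  assumes "(f has_sum s) A" "\<And>x. x \<in> A \<Longrightarrow> f x = g x"
  shows "(g has_sum s) A"
  using assms has_sum_cong by blast

lemma has_sum_diff:
  fixes f g :: "'a \<Rightarrow> 'b::real_normed_vector"
  assumes "(f has_sum a) A" "(g has_sum b) A"
  shows "((\<lambda>x. f x - g x) has_sum (a - b)) A"
  using has_sum_add[OF assms(1), of "\<lambda>x. - g x" "- b"] assms(2) by (simp add: has_sum_uminus)

lemma has_sum_finite_family:
  fixes f :: "'i \<Rightarrow> 'a \<Rightarrow> 'b::{topological_comm_monoid_add}"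
  assumes "finite I" "\<And>i. i \<in> I \<Longrightarrow> (f i has_sum s i) A"
  shows "((\<lambda>x. \<Sum>i\<in>I. f i x) has_sum (\<Sum>i\<in>I. s i)) A"
  using assms by (induction I rule: finite_induct) (auto intro!: has_sum_add)

lemma has_sum_cinner_left:
  fixes s :: "'a::complex_inner"
  shows "(f has_sum s) A \<Longrightarrow> ((\<lambda>x. cinner (f x) y) has_sum cinner s y) A"
  using has_sum_bounded_linear[OF bounded_linear_cinner_left] by blast

lemma has_sum_scaleC:
  fixes s :: "'a::complex_inner"
  shows "(f has_sum s) A \<Longrightarrow> ((\<lambda>x. scaleC a (f x)) has_sum scaleC a s) A"
  using has_sum_bounded_linear[OF bounded_linear_scaleC] by blast

section \<open>Multi-indices\<close>

definition mdeg :: "nat \<Rightarrow> (nat \<Rightarrow> nat) \<Rightarrow> nat" where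
  "mdeg n \<alpha> = (\<Sum>i<n. \<alpha> i)"

definition inc :: "nat \<Rightarrow> (nat \<Rightarrow> nat) \<Rightarrow> nat \<Rightarrow> nat" where
  "inc i \<alpha> = \<alpha>(i := Suc (\<alpha> i))"

text \<open>Truncated subtraction makes \<open>dec i\<close> the identity where the entry is 0, so
  sums that use it run only over the \<open>i\<close> with \<open>0 < \<beta> i\<close>.\<close>

definition dec :: "nat \<Rightarrow> (nat \<Rightarrow> nat) \<Rightarrow> nat \<Rightarrow> nat" where
  "dec i \<alpha> = \<alpha>(i := \<alpha> i - 1)"

lemma zero_multi_idx [simp]: "(\<lambda>_. 0) \<in> multi_idx n"
  by (simp add: multi_idx_def)

lemma inc_multi_idx: "i < n \<Longrightarrow> \<alpha> \<in> multi_idx n \<Longrightarrow> inc i \<alpha> \<in> multi_idx n"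
  by (auto simp: multi_idx_def inc_def)

lemma dec_multi_idx: "\<alpha> \<in> multi_idx n \<Longrightarrow> dec i \<alpha> \<in> multi_idx n"
  by (auto simp: multi_idx_def dec_def)

lemma inc_dec: "0 < \<alpha> i \<Longrightarrow> inc i (dec i \<alpha>) = \<alpha>"
  by (auto simp: inc_def dec_def)

lemma dec_inc [simp]: "dec i (inc i \<alpha>) = \<alpha>"
  by (auto simp: inc_def dec_def)

lemma inc_same [simp]: "inc i \<alpha> i = Suc (\<alpha> i)"
  by (simp add: inc_def)

lemma multi_idx_nonzeroE:
  assumes "\<alpha> \<in> multi_idx n" "\<alpha> \<noteq> (\<lambda>_. 0)"
  obtains i where "i < n" "0 < \<alpha> i"
proof -
  obtain i where "\<alpha> i \<noteq> 0" using assms(2) by auto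
  moreover from this have "i < n"
    using assms(1) unfolding multi_idx_def by (metis (mono_tags, lifting) linorder_not_le mem_Collect_eq)
  ultimately show thesis using that[of i] by simp
qed

lemma mdeg_inc: "i < n \<Longrightarrow> mdeg n (inc i \<alpha>) = Suc (mdeg n \<alpha>)"
proof -
  assume i: "i < n"
  have "mdeg n (inc i \<alpha>) = (\<Sum>j<n. \<alpha> j + (if j = i then 1 else 0))"
    unfolding mdeg_def by (rule sum.cong) (auto simp: inc_def)
  also have "\<dots> = Suc (mdeg n \<alpha>)"
    using i by (simp add: sum.distrib mdeg_def)
  finally show ?thesis .
qed

lemma mdeg_dec: "i < n \<Longrightarrow> 0 < \<beta> i \<Longrightarrow> mdeg n \<beta> = Suc (mdeg n (dec i \<beta>))"
  using mdeg_inc[of i n "dec i \<beta>"] by (simp add: inc_dec)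

lemma mdeg_pos: "\<beta> \<in> multi_idx n \<Longrightarrow> \<beta> \<noteq> (\<lambda>_. 0) \<Longrightarrow> 0 < mdeg n \<beta>"
  by (elim multi_idx_nonzeroE) (simp_all add: mdeg_dec)

lemma finite_multi_idx_mdeg: "finite {\<alpha> \<in> multi_idx n. mdeg n \<alpha> = l}"
proof (rule finite_subset)
  show "{\<alpha> \<in> multi_idx n. mdeg n \<alpha> = l} \<subseteq>
    {\<alpha>. (\<forall>i. i \<in> {..<n} \<longrightarrow> \<alpha> i \<in> {..l}) \<and> (\<forall>i. i \<notin> {..<n} \<longrightarrow> \<alpha> i = 0)}"
    by (auto simp: multi_idx_def mdeg_def intro: member_le_sum)
  show "finite {\<alpha>. (\<forall>i. i \<in> {..<n} \<longrightarrow> \<alpha> i \<in> {..l}) \<and> (\<forall>i. i \<notin> {..<n} \<longrightarrow> \<alpha> i = 0)}"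
    using finite_set_of_finite_funs[of "{..<n}" "{..l}" "0::nat"] by (simp add: all_conj_distrib)
qed

lemma has_sum_multi_idxI:
  fixes f :: "(nat \<Rightarrow> nat) \<Rightarrow> 'b::real_normed_vector"
  assumes "(f has_sum s) {\<beta> \<in> multi_idx n. \<beta> \<noteq> (\<lambda>_. 0)}"
  shows "(f has_sum (f (\<lambda>_. 0) + s)) (multi_idx n)"
proof -
  have "multi_idx n = insert (\<lambda>_. 0) {\<beta> \<in> multi_idx n. \<beta> \<noteq> (\<lambda>_. 0)}" by auto
  then show ?thesis using has_sum_insert[OF _ assms, of "\<lambda>_. 0"] by simp
qed

text \<open>Summation over pairs \<open>(i, \<alpha>)\<close> rewritten as a summation over \<open>\<beta> = \<alpha> + e\<^sub>i\<close>.\<close>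

lemma has_sum_shift_multi_idx:
  fixes G :: "nat \<Rightarrow> (nat \<Rightarrow> nat) \<Rightarrow> 'b::{topological_comm_monoid_add,t2_space}"
  assumes "\<And>i. i < n \<Longrightarrow> (G i has_sum S i) {\<alpha> \<in> multi_idx n. P (mdeg n \<alpha>)}"
  shows "((\<lambda>\<beta>. \<Sum>i | i < n \<and> 0 < \<beta> i. G i (dec i \<beta>)) has_sum (\<Sum>i<n. S i))
           {\<beta> \<in> multi_idx n. \<beta> \<noteq> (\<lambda>_. 0) \<and> P (mdeg n \<beta> - 1)}" (is "(_ has_sum _) ?A")
proof -
  \<comment> \<open>Extension by zero puts all \<open>n\<close> reindexed families on the one index
    set \<open>?A\<close>, where they can be added.\<close>
  have *: "((\<lambda>\<beta>. if 0 < \<beta> i then G i (dec i \<beta>) else 0) has_sum S i) ?A" if i: "i < n" for i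
  proof -
    have bij: "bij_betw (inc i) {\<alpha> \<in> multi_idx n. P (mdeg n \<alpha>)}
        {\<beta> \<in> multi_idx n. 0 < \<beta> i \<and> P (mdeg n \<beta> - 1)}"
      by (rule bij_betwI[where g = "dec i"])
        (use i in \<open>auto simp: inc_multi_idx dec_multi_idx mdeg_inc mdeg_dec inc_dec\<close>)
    have "((\<lambda>\<alpha>. (\<lambda>\<beta>. G i (dec i \<beta>)) (inc i \<alpha>)) has_sum S i) {\<alpha> \<in> multi_idx n. P (mdeg n \<alpha>)}"
      using assms[OF i] by simp
    then have "((\<lambda>\<beta>. G i (dec i \<beta>)) has_sum S i) {\<beta> \<in> multi_idx n. 0 < \<beta> i \<and> P (mdeg n \<beta> - 1)}"
      using has_sum_reindex_bij_betw[OF bij, of "\<lambda>\<beta>. G i (dec i \<beta>)"] by blast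
    then show ?thesis
      by (rule has_sum_cong_neutral[THEN iffD1, rotated -1]) auto
  qed
  have "((\<lambda>\<beta>. \<Sum>i<n. if 0 < \<beta> i then G i (dec i \<beta>) else 0) has_sum (\<Sum>i<n. S i)) ?A"
    by (rule has_sum_finite_family) (use * in auto)
  moreover have "(\<Sum>i<n. if 0 < \<beta> i then G i (dec i \<beta>) else 0)
      = (\<Sum>i | i < n \<and> 0 < \<beta> i. G i (dec i \<beta>))" for \<beta> :: "nat \<Rightarrow> nat"
    by (simp add: sum.inter_filter[symmetric] lessThan_def)
  ultimately show ?thesis by simp
qed

section \<open>The weights\<close>

lemma rho_pos: "0 < rho m n \<alpha>"
  by (simp add: rho_def prod_pos)

lemma rho_zero: "1 \<le> m \<Longrightarrow> rho m n (\<lambda>_. 0) = 1"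
  by (simp add: rho_def)

text \<open>\<open>rho 1 n \<alpha>\<close> is the multinomial coefficient of
  \<open>\<alpha>\<close>, and the other factor depends on the degree only. The weight is thus the
  coefficient of z^alpha in (1 - s)^(-(k+1)), where s is the sum of the variables.\<close>

lemma rho_binomial: "rho (Suc k) n \<alpha> = real ((k + mdeg n \<alpha>) choose mdeg n \<alpha>) * rho 1 n \<alpha>"
  by (simp add: rho_def mdeg_def[symmetric] binomial_fact[of "mdeg n \<alpha>" "k + mdeg n \<alpha>"])

text \<open>Lowering entry \<open>i\<close> divides the product of factorials by
  \<open>\<beta> i\<close>. Apart from the resulting factor \<open>\<beta> i\<close>, the value does
  not depend on \<open>i\<close>.\<close>

lemma rho_dec:
  assumes "i < n" "0 < \<beta> i"
  shows "rho (Suc k) n (dec i \<beta>)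
    = \<beta> i * (fact (k + mdeg n \<beta> - 1) / ((\<Prod>i<n. fact (\<beta> i)) * fact k))"
proof -
  have 1: "(\<Prod>j<n. fact (\<beta> j)) = real (\<beta> i) * (\<Prod>j<n. fact (dec i \<beta> j))"
  proof -
    have "(\<Prod>j<n. fact (\<beta> j)) = fact (\<beta> i) * (\<Prod>j\<in>{..<n}-{i}. fact (\<beta> j) :: real)"
      using assms by (subst prod.remove[of _ i]) auto
    also have "fact (\<beta> i) = real (\<beta> i) * fact (\<beta> i - 1)"
      using assms by (simp add: fact_reduce)
    also have "(\<Prod>j\<in>{..<n}-{i}. fact (\<beta> j) :: real) = (\<Prod>j\<in>{..<n}-{i}. fact (dec i \<beta> j))"
      by (rule prod.cong) (auto simp: dec_def)
    finally show ?thesis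
      using assms by (subst (2) prod.remove[of _ i]) (auto simp: dec_def)
  qed
  have 2: "Suc k + (\<Sum>j<n. dec i \<beta> j) - 1 = k + mdeg n \<beta> - 1"
    using mdeg_dec[of i n \<beta>] assms by (simp add: mdeg_def)
  have "(\<Prod>j<n. fact (dec i \<beta> j)) \<noteq> (0::real)" by simp
  then show ?thesis
    unfolding rho_def 1 2 using assms by simp
qed

lemma sum_rho_dec:
  fixes \<beta> :: "nat \<Rightarrow> nat"
  shows "(\<Sum>i | i < n \<and> 0 < \<beta> i. rho (Suc k) n (dec i \<beta>))
    = mdeg n \<beta> * (fact (k + mdeg n \<beta> - 1) / ((\<Prod>i<n. fact (\<beta> i)) * fact k))"
proof -
  have "(\<Sum>i | i < n \<and> 0 < \<beta> i. rho (Suc k) n (dec i \<beta>))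
    = (\<Sum>i | i < n \<and> 0 < \<beta> i. \<beta> i * (fact (k + mdeg n \<beta> - 1) / ((\<Prod>i<n. fact (\<beta> i)) * fact k)))"
    by (rule sum.cong) (auto simp: rho_dec)
  also have "\<dots> = (\<Sum>i | i < n \<and> 0 < \<beta> i. real (\<beta> i)) * (fact (k + mdeg n \<beta> - 1) / ((\<Prod>i<n. fact (\<beta> i)) * fact k))"
    by (simp only: sum_distrib_right)
  also have "(\<Sum>i | i < n \<and> 0 < \<beta> i. real (\<beta> i)) = mdeg n \<beta>"
    unfolding mdeg_def of_nat_sum by (rule sum.mono_neutral_left) auto
  finally show ?thesis .
qed

text \<open>Pascal's rule for multinomial coefficients: a nonempty word with content
  \<open>\<beta>\<close> begins with some letter \<open>i\<close> such that
  \<open>0 < \<beta> i\<close>.\<close>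

lemma rho_1_recurrence:
  fixes \<beta> :: "nat \<Rightarrow> nat"
  assumes "0 < mdeg n \<beta>"
  shows "rho 1 n \<beta> = (\<Sum>i | i < n \<and> 0 < \<beta> i. rho 1 n (dec i \<beta>))"
proof -
  have "(\<Sum>i | i < n \<and> 0 < \<beta> i. rho 1 n (dec i \<beta>))
     = mdeg n \<beta> * (fact (mdeg n \<beta> - 1) / ((\<Prod>i<n. fact (\<beta> i))))"
    using sum_rho_dec[where k = 0] by simp
  also have "\<dots> = fact (mdeg n \<beta>) / (\<Prod>i<n. fact (\<beta> i))"
    using assms by (simp add: fact_reduce)
  finally show ?thesis by (simp add: rho_def mdeg_def)
qed

text \<open>Coefficientwise form of (1 - s)^(-(k+1)) = (1 - s)^(-k) + s (1 - s)^(-(k+1)), where s is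
  the sum of the variables.\<close>

lemma rho_Suc_recurrence:
  assumes "0 < mdeg n \<beta>" "1 \<le> k"
  shows "rho (Suc k) n \<beta> = rho k n \<beta> + (\<Sum>i | i < n \<and> 0 < \<beta> i. rho (Suc k) n (dec i \<beta>))"
proof -
  obtain j where k: "k = Suc j" using assms(2) by (cases k) auto
  define P :: real where "P = (\<Prod>i<n. fact (\<beta> i))"
  have P: "P \<noteq> 0" by (simp add: P_def)
  show ?thesis
    unfolding sum_rho_dec unfolding rho_def mdeg_def[symmetric] P_def[symmetric] k
    using P by (simp add: divide_simps) (simp add: algebra_simps)
qed

text \<open>The recurrences telescope: s times the sum of (1 - s)^(-k) over k = 1..m is (1 - s)^(-m)
  - 1. The subtracted 1 sits in degree 0, hence the assumption of positive degree.\<close>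

lemma sum_rho_dec_upto:
  assumes "0 < mdeg n \<beta>" "1 \<le> m"
  shows "(\<Sum>i | i < n \<and> 0 < \<beta> i. \<Sum>k=1..m. rho k n (dec i \<beta>)) = rho m n \<beta>"
  using assms(2)
proof (induction m rule: dec_induct)
  case base
  show ?case using rho_1_recurrence[OF assms(1)] by simp
next
  case (step k)
  then show ?case using rho_Suc_recurrence[OF assms(1), of k] by (simp add: sum.distrib)
qed

section \<open>Weighted sums over words in commuting maps\<close>

definition commuting :: "nat \<Rightarrow> (nat \<Rightarrow> 'x \<Rightarrow> 'x) \<Rightarrow> bool" where
  "commuting n S \<longleftrightarrow> (\<forall>i<n. \<forall>j<n. \<forall>u. S i (S j u) = S j (S i u))"

text \<open>If \<open>S\<close> is the tuple of adjoints and \<open>F\<close> the quadratic form of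
  an operator X, this is the quadratic form of sigma_T(X). Operator series become series of reals in
  this way.\<close>

definition wsum :: "nat \<Rightarrow> (nat \<Rightarrow> 'x \<Rightarrow> 'x) \<Rightarrow> ('x \<Rightarrow> real) \<Rightarrow> 'x \<Rightarrow> real" where
  "wsum n S F = (\<lambda>u. \<Sum>i<n. F (S i u))"

lemma wsum_funpow_Suc: "(wsum n S ^^ Suc l) F u = (\<Sum>i<n. (wsum n S ^^ l) F (S i u))"
  by (simp add: wsum_def)

lemma wsum_funpow_nonneg: "(\<And>u. 0 \<le> F u) \<Longrightarrow> 0 \<le> (wsum n S ^^ l) F u"
  by (induction l arbitrary: u) (auto simp: wsum_def intro: sum_nonneg)

lemma wsum_funpow_diff:
  "(wsum n S ^^ l) (\<lambda>u. F u - G u) u = (wsum n S ^^ l) F u - (wsum n S ^^ l) G u"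
  by (induction l arbitrary: u) (auto simp: wsum_def sum_subtractf)

lemma wsum_funpow_sums:
  assumes "\<And>u. (\<lambda>l. c l * (wsum n S ^^ l) F u) sums G u"
  shows "(\<lambda>l. c l * (wsum n S ^^ (p + l)) F u) sums (wsum n S ^^ p) G u"
proof (induction p arbitrary: u)
  case 0
  show ?case using assms by simp
next
  case (Suc p)
  have "(\<lambda>l. \<Sum>i<n. c l * (wsum n S ^^ (p + l)) F (S i u)) sums (\<Sum>i<n. (wsum n S ^^ p) G (S i u))"
    by (rule sums_sum) (rule Suc)
  then show ?case by (simp only: wsum_funpow_Suc add_Suc sum_distrib_left)
qed

text \<open>With \<sigma> for \<open>wsum n S\<close>, the assumption says formally that
  \<open>F (Suc j)\<close> is (1 - \<sigma>)^(-1) applied to \<open>F j\<close>. Hence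
  \<open>F (Suc k)\<close> is (1 - \<sigma>)^(-(k+1)) applied to \<open>F 0\<close>, expanded as a
  negative binomial series. Nonnegativity licenses the rearrangement.\<close>

lemma sums_binomial_wsum:
  assumes nonneg: "\<And>j u. j \<le> k \<Longrightarrow> 0 \<le> F j u"
    and step: "\<And>j u. j \<le> k \<Longrightarrow> (\<lambda>l. (wsum n S ^^ l) (F j) u) sums F (Suc j) u"
  shows "(\<lambda>l. real ((k + l) choose l) * (wsum n S ^^ l) (F 0) u) sums F (Suc k) u"
  using assms
proof (induction k arbitrary: u)
  case 0
  show ?case using 0(2)[of 0 u] by simp
next
  case (Suc k)
  have IH: "(\<lambda>l. real ((k + l) choose l) * (wsum n S ^^ l) (F 0) u) sums F (Suc k) u" for u
    using Suc by simp
  define a where "a l = (wsum n S ^^ l) (F 0) u" for l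
  \<comment> \<open>Term \<open>(p, l)\<close> is the \<open>l\<close>-th term of the series
    obtained by expanding the \<open>p\<close>-th term of the series for
    \<open>F (Suc (Suc k))\<close>.\<close>
  define f where "f = (\<lambda>(p, l). real ((k + l) choose l) * a (p + l))"
  have a: "0 \<le> a l" for l unfolding a_def by (rule wsum_funpow_nonneg) (simp add: Suc.prems)
  have inner: "((\<lambda>l. f (p, l)) has_sum (wsum n S ^^ p) (F (Suc k)) u) UNIV" for p
    unfolding f_def prod.case a_def
    by (rule sums_nonneg_imp_has_sum[OF wsum_funpow_sums[where c = "\<lambda>l. real ((k + l) choose l)"]])
      (use IH Suc.prems(1) in \<open>auto intro!: mult_nonneg_nonneg wsum_funpow_nonneg\<close>)
  have outer: "((\<lambda>p. (wsum n S ^^ p) (F (Suc k)) u) has_sum F (Suc (Suc k)) u) UNIV"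
    by (rule sums_nonneg_imp_has_sum) (use Suc.prems in \<open>auto intro!: wsum_funpow_nonneg\<close>)
  have "f summable_on (SIGMA p:UNIV. UNIV)"
    by (rule summable_on_SigmaI[OF inner]) (use outer a in \<open>auto simp: f_def summable_on_def\<close>)
  then have "(f has_sum F (Suc (Suc k)) u) (SIGMA p:UNIV. UNIV)"
    by (intro has_sum_SigmaI[OF inner outer])
  \<comment> \<open>Along an antidiagonal p + l = q the factor \<open>a q\<close> is common, and the
    binomial coefficients add up by the hockey-stick identity.\<close>
  moreover have bij: "bij_betw (\<lambda>(q, l). (q - l, l)) (SIGMA q:UNIV. {..q}) (SIGMA p:UNIV. (UNIV::nat set))"
    by (rule bij_betwI[where g = "\<lambda>(p, l). (p + l, l)"]) auto
  ultimately have "((\<lambda>x. f ((\<lambda>(q, l). (q - l, l)) x)) has_sum F (Suc (Suc k)) u) (SIGMA q:UNIV. {..q})"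
    using has_sum_reindex_bij_betw[OF bij, of f] by blast
  then have "((\<lambda>q. \<Sum>l\<le>q. f (q - l, l)) has_sum F (Suc (Suc k)) u) UNIV"
    by (rule has_sum_SigmaD) (auto intro!: has_sum_finiteI)
  moreover have "(\<Sum>l\<le>q. f (q - l, l)) = real ((Suc k + q) choose q) * a q" for q
  proof -
    have "(\<Sum>l\<le>q. f (q - l, l)) = (\<Sum>l\<le>q. real ((k + l) choose l) * a q)"
      by (rule sum.cong) (auto simp: f_def)
    also have "\<dots> = real (\<Sum>l\<le>q. (k + l) choose l) * a q"
      by (simp add: sum_distrib_right)
    finally show ?thesis by (simp only: sum_choose_lower add_Suc)
  qed
  ultimately show ?case
    unfolding a_def using has_sum_imp_sums by simp
qed

section \<open>Mixed powers of commuting tuples and the multinomial theorem\<close>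

lemma opmpow_zero: "opmpow n S (\<lambda>_. 0) u = u"
  by (induction n) auto

lemma opmpow_cong: "(\<And>i. i < n \<Longrightarrow> \<alpha> i = \<beta> i) \<Longrightarrow> opmpow n S \<alpha> = opmpow n S \<beta>"
  by (induction n) auto

lemma funpow_apply_commute:
  "(\<And>u. f (g u) = g (f u)) \<Longrightarrow> (f ^^ k) (g u) = g ((f ^^ k) u)"
  by (induction k) auto

lemma opmpow_commute:
  assumes "\<And>i u. i < n \<Longrightarrow> S i (g u) = g (S i u)"
  shows "opmpow n S \<alpha> (g u) = g (opmpow n S \<alpha> u)"
  using assms by (induction n) (auto simp: funpow_apply_commute)

lemma opmpow_inc:
  assumes comm: "commuting n S" and "i < n"
  shows "opmpow n S (inc i \<alpha>) u = opmpow n S \<alpha> (S i u)"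
  using assms
proof (induction n)
  case (Suc n)
  show ?case
  proof (cases "i = n")
    case True
    have "opmpow n S (inc i \<alpha>) = opmpow n S \<alpha>"
      using True by (intro opmpow_cong) (auto simp: inc_def)
    then show ?thesis
      using True Suc.prems(1)
      by (simp add: commuting_def opmpow_commute[of n S "S n"] funpow_swap1)
  next
    case False
    then show ?thesis using Suc by (simp add: inc_def commuting_def)
  qed
qed simp

lemma opmpow_add:
  assumes comm: "commuting n S"
  shows "opmpow n S (\<lambda>i. \<alpha> i + \<gamma> i) u = opmpow n S \<gamma> (opmpow n S \<alpha> u)"
  using assms
proof (induction n)
  case (Suc n)
  have "opmpow n S \<gamma> ((S n ^^ \<alpha> n) v) = (S n ^^ \<alpha> n) (opmpow n S \<gamma> v)" for v
    by (rule opmpow_commute) (metis Suc.prems commuting_def funpow_apply_commute less_Suc_eq)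
  then show ?case
    using Suc by (simp add: commuting_def funpow_add add.commute[of "\<alpha> n"])
qed simp

lemma multi_idx_mdeg_0: "{\<alpha> \<in> multi_idx n. mdeg n \<alpha> = 0} = {\<lambda>_. 0}"
  using mdeg_pos[of _ n] by (fastforce simp: mdeg_def[of n "\<lambda>_. 0"])

text \<open>The left side runs over words of length \<open>l\<close>; by commutativity,
  \<open>rho 1 n \<alpha>\<close> of them act as the same mixed power. The induction peels off one
  letter and uses Pascal's rule.\<close>

lemma wsum_funpow_opmpow:
  assumes comm: "commuting n S"
  shows "(wsum n S ^^ l) F u = (\<Sum>\<alpha> | \<alpha> \<in> multi_idx n \<and> mdeg n \<alpha> = l. rho 1 n \<alpha> * F (opmpow n S \<alpha> u))"
proof (induction l arbitrary: u)
  case 0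
  show ?case by (simp add: multi_idx_mdeg_0 rho_zero opmpow_zero)
next
  case (Suc l)
  define G where "G i \<alpha> = rho 1 n \<alpha> * F (opmpow n S (inc i \<alpha>) u)" for i \<alpha>
  have "(G i has_sum (wsum n S ^^ l) F (S i u)) {\<alpha> \<in> multi_idx n. mdeg n \<alpha> = l}" if "i < n" for i
    unfolding Suc G_def using opmpow_inc[OF comm that]
    by (intro has_sum_finiteI finite_multi_idx_mdeg sum.cong) auto
  from has_sum_shift_multi_idx[where P = "\<lambda>d. d = l", OF this]
  have "((\<lambda>\<beta>. \<Sum>i | i < n \<and> 0 < \<beta> i. G i (dec i \<beta>)) has_sum (wsum n S ^^ Suc l) F u)
      {\<beta> \<in> multi_idx n. \<beta> \<noteq> (\<lambda>_. 0) \<and> mdeg n \<beta> - 1 = l}"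
    unfolding wsum_funpow_Suc .
  also have "{\<beta> \<in> multi_idx n. \<beta> \<noteq> (\<lambda>_. 0) \<and> mdeg n \<beta> - 1 = l} = {\<beta> \<in> multi_idx n. mdeg n \<beta> = Suc l}"
    using mdeg_pos[of _ n] by (fastforce simp: mdeg_def)
  finally have "(wsum n S ^^ Suc l) F u
      = (\<Sum>\<beta> | \<beta> \<in> multi_idx n \<and> mdeg n \<beta> = Suc l. \<Sum>i | i < n \<and> 0 < \<beta> i. G i (dec i \<beta>))"
    using has_sum_unique[OF _ has_sum_finite] finite_multi_idx_mdeg by blast
  also have "\<dots> = (\<Sum>\<beta> | \<beta> \<in> multi_idx n \<and> mdeg n \<beta> = Suc l. rho 1 n \<beta> * F (opmpow n S \<beta> u))"
  proof (rule sum.cong)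
    fix \<beta> assume "\<beta> \<in> {\<beta> \<in> multi_idx n. mdeg n \<beta> = Suc l}"
    then have "rho 1 n \<beta> = (\<Sum>i | i < n \<and> 0 < \<beta> i. rho 1 n (dec i \<beta>))"
      by (intro rho_1_recurrence) simp
    then show "(\<Sum>i | i < n \<and> 0 < \<beta> i. G i (dec i \<beta>)) = rho 1 n \<beta> * F (opmpow n S \<beta> u)"
      by (simp add: G_def inc_dec sum_distrib_right)
  qed simp
  finally show ?case .
qed

text \<open>Turns a series ordered by degree into an unconditional sum over multi-indices. Each
  degree is a finite block given by the multinomial theorem, and nonnegativity makes the double sum
  converge unconditionally.\<close>

lemma has_sum_rho_opmpow:
  assumes comm: "commuting n S"
    and nonneg: "\<And>u. 0 \<le> F u"
    and sums: "(\<lambda>l. real ((k + l) choose l) * (wsum n S ^^ l) F u) sums s"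
  shows "((\<lambda>\<alpha>. rho (Suc k) n \<alpha> * F (opmpow n S \<alpha> u)) has_sum s) (multi_idx n)"
proof -
  define f where "f \<alpha> = rho (Suc k) n \<alpha> * F (opmpow n S \<alpha> u)" for \<alpha>
  let ?D = "\<lambda>l. {\<alpha> \<in> multi_idx n. mdeg n \<alpha> = l}"
  have outer: "((\<lambda>l. real ((k + l) choose l) * (wsum n S ^^ l) F u) has_sum s) UNIV"
    by (rule sums_nonneg_imp_has_sum[OF sums])
      (auto intro!: mult_nonneg_nonneg wsum_funpow_nonneg nonneg)
  have inner: "((\<lambda>\<alpha>. f (snd (l, \<alpha>))) has_sum (real ((k + l) choose l) * (wsum n S ^^ l) F u)) (?D l)" for l
    unfolding wsum_funpow_opmpow[OF comm] sum_distrib_left f_def snd_conv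
    using rho_binomial[of k n]
    by (intro has_sum_finiteI[OF finite_multi_idx_mdeg] sum.cong) auto
  have "(\<lambda>x. f (snd x)) summable_on (SIGMA l:UNIV. ?D l)"
    by (rule summable_on_SigmaI[OF inner])
      (use outer in \<open>auto simp: f_def summable_on_def intro!: mult_nonneg_nonneg nonneg less_imp_le[OF rho_pos]\<close>)
  then have "((\<lambda>x. f (snd x)) has_sum s) (SIGMA l:UNIV. ?D l)"
    by (intro has_sum_SigmaI[OF inner outer])
  moreover have "bij_betw snd (SIGMA l:UNIV. ?D l) (multi_idx n)"
    by (rule bij_betwI[where g = "\<lambda>\<alpha>. (mdeg n \<alpha>, \<alpha>)"]) auto
  ultimately have "(f has_sum s) (multi_idx n)"
    using has_sum_reindex_bij_betw[of snd "SIGMA l:UNIV. ?D l" "multi_idx n" f] by blast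
  then show ?thesis by (simp add: f_def[abs_def])
qed

section \<open>Uniqueness of Taylor coefficients\<close>

text \<open>The constant term is the limit at 0, and division by \<open>t\<close> shifts the series.
  The assumption leaves out \<open>t = 0\<close> so that it survives this division.\<close>

lemma powser_coeffs_zero:
  fixes a :: "nat \<Rightarrow> complex"
  assumes "0 < r" "\<And>t. t \<noteq> 0 \<Longrightarrow> cmod t < r \<Longrightarrow> (\<lambda>j. a j * t ^ j) sums 0"
  shows "a j = 0"
  using assms(2)
proof (induction j arbitrary: a)
  case 0
  have "((\<lambda>t. 0) \<longlongrightarrow> a 0) (at (0::complex))"
    by (rule powser_limit_0_strong[OF assms(1)]) (rule 0)
  then show ?case by (simp add: tendsto_const_iff)
next
  case (Suc j)
  have a0: "a 0 = 0"
  proof -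
    have "((\<lambda>t. 0) \<longlongrightarrow> a 0) (at (0::complex))"
      by (rule powser_limit_0_strong[OF assms(1)]) (rule Suc)
    then show ?thesis by (simp add: tendsto_const_iff)
  qed
  show ?case
  proof (rule Suc.IH[of "\<lambda>j. a (Suc j)"])
    fix t :: complex assume t: "t \<noteq> 0" "cmod t < r"
    have "(\<lambda>j. a (Suc j) * t ^ Suc j) sums 0"
      using Suc.prems[OF t] a0 by (subst sums_Suc_iff) simp
    then have "(\<lambda>j. (a (Suc j) * t ^ Suc j) * inverse t) sums (0 * inverse t)"
      by (rule sums_mult2)
    then show "(\<lambda>j. a (Suc j) * t ^ j) sums 0"
      using t by (simp add: field_simps)
  qed
qed

lemma bij_betw_multi_idx_Suc:
  "bij_betw (\<lambda>(j, \<alpha>). \<alpha>(n := j)) (UNIV \<times> multi_idx n) (multi_idx (Suc n))"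
  by (rule bij_betwI[where g = "\<lambda>\<alpha>. (\<alpha> n, \<alpha>(n := 0))"]) (auto simp: multi_idx_def)

lemma mpow_Suc_fun_upd: "mpow (Suc n) (z(n := t)) (\<alpha>(n := j)) = t ^ j * mpow n z \<alpha>"
  by (simp add: mpow_def mult.commute)

text \<open>Induction on the number of variables. With the others fixed, the sum is a power series
  in the last variable; its coefficients vanish, so each slice with fixed last exponent satisfies
  the assumption in one variable fewer.\<close>

lemma multi_powser_coeffs_zero:
  fixes d :: "(nat \<Rightarrow> nat) \<Rightarrow> complex"
  assumes r: "0 < r"
    and "\<And>z. (\<And>i. i < n \<Longrightarrow> cmod (z i) < r) \<Longrightarrow> ((\<lambda>\<alpha>. mpow n z \<alpha> * d \<alpha>) has_sum 0) (multi_idx n)"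
    and "\<alpha> \<in> multi_idx n"
  shows "d \<alpha> = 0"
  using assms(2,3)
proof (induction n arbitrary: d \<alpha>)
  case 0
  have "multi_idx 0 = {\<lambda>_. 0}" by (auto simp: multi_idx_def)
  then show ?case using 0(1)[of "\<lambda>_. 0"] 0(2) by (simp add: has_sum_finite_iff mpow_def)
next
  case (Suc n)
  have slice: "((\<lambda>\<alpha>. mpow n z \<alpha> * d (\<alpha>(n := j))) has_sum 0) (multi_idx n)"
    if z: "\<And>i. i < n \<Longrightarrow> cmod (z i) < r" for z j
  proof -
    have sum: "((\<lambda>(j, \<alpha>). t ^ j * mpow n z \<alpha> * d (\<alpha>(n := j))) has_sum 0) (UNIV \<times> multi_idx n)"
      if t: "cmod t < r" for t
    proof -
      have "((\<lambda>\<alpha>. mpow (Suc n) (z(n := t)) \<alpha> * d \<alpha>) has_sum 0) (multi_idx (Suc n))"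
        by (rule Suc.prems(1)) (use z t in \<open>auto simp: less_Suc_eq\<close>)
      then show ?thesis
        using has_sum_reindex_bij_betw[OF bij_betw_multi_idx_Suc[of n],
            of "\<lambda>\<alpha>. mpow (Suc n) (z(n := t)) \<alpha> * d \<alpha>" 0]
        by (simp add: case_prod_unfold mpow_Suc_fun_upd)
    qed
    have "(\<lambda>\<alpha>. mpow n z \<alpha> * d (\<alpha>(n := j))) summable_on multi_idx n" for j
    proof -
      \<comment> \<open>Any nonzero point of the disc would do in place of \<open>r/2\<close>: its
        power is divided out again to leave summability of the slice.\<close>
      have "(\<lambda>(j, \<alpha>). of_real (r/2) ^ j * mpow n z \<alpha> * d (\<alpha>(n := j))) summable_on (UNIV \<times> multi_idx n)"
        using sum[of "of_real (r/2)"] r by (auto intro: has_sum_imp_summable)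
      then have "(\<lambda>\<alpha>. of_real (r/2) ^ j * mpow n z \<alpha> * d (\<alpha>(n := j))) summable_on multi_idx n"
        using summable_on_SigmaD1[where A = UNIV and B = "\<lambda>_. multi_idx n"] by auto
      then have "(\<lambda>\<alpha>. (1 / of_real (r/2) ^ j) * (of_real (r/2) ^ j * mpow n z \<alpha> * d (\<alpha>(n := j)))) summable_on multi_idx n"
        by (rule summable_on_cmult_right)
      then show ?thesis using r by simp
    qed
    then obtain e where e: "\<And>j. ((\<lambda>\<alpha>. mpow n z \<alpha> * d (\<alpha>(n := j))) has_sum e j) (multi_idx n)"
      unfolding summable_on_def by metis
    have "e j = 0"
    proof (rule powser_coeffs_zero[OF r])
      fix t assume "cmod t < r"
      from sum[OF this] have "((\<lambda>j. e j * t ^ j) has_sum 0) UNIV"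
        by (rule has_sum_SigmaD) (use has_sum_cmult_right[OF e] in \<open>simp add: mult.assoc mult.commute[of "e _"]\<close>)
      then show "(\<lambda>j. e j * t ^ j) sums 0" by (rule has_sum_imp_sums)
    qed
    with e[of j] show ?thesis by simp
  qed
  have "\<alpha>(n := 0) \<in> multi_idx n"
    using Suc.prems(2) by (auto simp: multi_idx_def)
  from Suc.IH[where d = "\<lambda>\<beta>. d (\<beta>(n := \<alpha> n))", OF slice this]
  show ?case by (simp only: fun_upd_upd fun_upd_triv)
qed

text \<open>Pairing with a vector reduces this to scalar power series on a polydisc. It makes the
  choice in \<open>Hm_coeff\<close> harmless on \<open>multi_idx n\<close>.\<close>

lemma Hm_rep_unique:
  fixes f :: "(nat \<Rightarrow> complex) \<Rightarrow> 'e::chilbert_space"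
  assumes c: "Hm_rep n c f" and c': "Hm_rep n c' f" and \<alpha>: "\<alpha> \<in> multi_idx n"
  shows "c \<alpha> = c' \<alpha>"
proof (rule cinner_eq_leftI)
  fix y :: 'e
  \<comment> \<open>The polydisc of this radius lies in the ball, as n r^2 = n/(n + 1) < 1; the
    added 1 makes the inequality strict and covers n = 0.\<close>
  define r where "r = 1 / sqrt (real n + 1)"
  have r: "0 < r" by (simp add: r_def)
  have "cinner (c \<alpha>) y - cinner (c' \<alpha>) y = 0"
  proof (rule multi_powser_coeffs_zero[OF r _ \<alpha>, where d = "\<lambda>\<alpha>. cinner (c \<alpha>) y - cinner (c' \<alpha>) y"])
    fix z :: "nat \<Rightarrow> complex" assume z: "\<And>i. i < n \<Longrightarrow> cmod (z i) < r"
    have "(\<Sum>i<n. (cmod (z i))\<^sup>2) \<le> (\<Sum>i<n. r\<^sup>2)"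
      by (intro sum_mono power_mono) (use z in \<open>auto intro: less_imp_le\<close>)
    also have "\<dots> < 1" by (simp add: r_def power_divide)
    finally have z: "z \<in> ballN n" by (simp add: ballN_def)
    have "((\<lambda>\<alpha>. cinner (scaleC (mpow n z \<alpha>) (c \<alpha>)) y) has_sum cinner (f z) y) (multi_idx n)"
         "((\<lambda>\<alpha>. cinner (scaleC (mpow n z \<alpha>) (c' \<alpha>)) y) has_sum cinner (f z) y) (multi_idx n)"
      using c c' z unfolding Hm_rep_def by (auto intro: has_sum_cinner_left)
    then have "((\<lambda>\<alpha>. cinner (scaleC (mpow n z \<alpha>) (c \<alpha>)) y - cinner (scaleC (mpow n z \<alpha>) (c' \<alpha>)) y)
        has_sum (cinner (f z) y - cinner (f z) y)) (multi_idx n)"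
      by (rule has_sum_diff)
    then show "((\<lambda>\<alpha>. mpow n z \<alpha> * (cinner (c \<alpha>) y - cinner (c' \<alpha>) y)) has_sum 0) (multi_idx n)"
      by (simp add: cinner_scaleC_left right_diff_distrib)
  qed
  then show "cinner (c \<alpha>) y = cinner (c' \<alpha>) y" by simp
qed

lemma Hm_coeff_eq:
  assumes "Hm_rep n c f" "\<alpha> \<in> multi_idx n"
  shows "Hm_coeff n f \<alpha> = c \<alpha>"
proof (rule Hm_rep_unique[OF _ assms])
  show "Hm_rep n (Hm_coeff n f) f"
    unfolding Hm_coeff_def by (rule someI[of "\<lambda>c. Hm_rep n c f", OF assms(1)])
qed

lemma Hm_inner_eq:
  assumes "Hm_rep n c f" "Hm_rep n d g"
  shows "Hm_inner m n f g = (\<Sum>\<^sub>\<infinity>\<alpha>\<in>multi_idx n. cinner (c \<alpha>) (d \<alpha>) / complex_of_real (rho m n \<alpha>))"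
  unfolding Hm_inner_def by (rule infsum_cong) (simp add: Hm_coeff_eq[OF assms(1)] Hm_coeff_eq[OF assms(2)])

section \<open>Monomials, powers of scaled tuples and binomial series\<close>

lemma mpow_zero [simp]: "mpow n z (\<lambda>_. 0) = 1"
  by (simp add: mpow_def)

lemma mpow_add: "mpow n z (\<lambda>i. \<alpha> i + \<beta> i) = mpow n z \<alpha> * mpow n z \<beta>"
  by (simp add: mpow_def power_add prod.distrib)

lemma mpow_inc:
  assumes "i < n"
  shows "mpow n z (inc i \<alpha>) = z i * mpow n z \<alpha>"
  using assms by (simp add: mpow_def inc_def prod.remove[of _ i])

text \<open>Absorbs the monomial into the tuple, so that the sums over words apply to power series
  in \<open>z\<close>.\<close>

lemma opmpow_scaleC:
  assumes "\<And>i. i < n \<Longrightarrow> clinear (S i)"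
  shows "opmpow n (\<lambda>i u. scaleC (z i) (S i u)) \<alpha> u = scaleC (mpow n z \<alpha>) (opmpow n S \<alpha> u)"
  using assms
proof (induction n)
  case (Suc n)
  have "((\<lambda>u. scaleC (z n) (S n u)) ^^ k) (scaleC c v) = scaleC (z n ^ k * c) ((S n ^^ k) v)" for k c v
    by (induction k) (auto simp: scaleC_scaleC clinear_scaleC[OF Suc.prems[of n]] mult.assoc)
  then show ?case
    using Suc by (simp add: mpow_def mult.commute)
qed (simp add: mpow_def scaleC_one)

lemma clinear_funpow:
  fixes f :: "'a \<Rightarrow> 'a::complex_inner"
  shows "clinear f \<Longrightarrow> clinear (f ^^ k)"
  by (induction k) (auto simp: clinear_def)

lemma opmpow_clinear:
  assumes "\<And>i. i < n \<Longrightarrow> clinear (S i)"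
  shows "clinear (opmpow n S \<alpha>)"
  using assms
proof (induction n)
  case (Suc n)
  then show ?case using clinear_funpow[of "S n" "\<alpha> n"] by (simp add: clinear_def)
qed (simp add: clinear_def)

text \<open>A Cauchy product with the geometric series raises \<open>k\<close> by one, again by the
  hockey-stick identity.\<close>

lemma summable_binomial_power:
  assumes "0 \<le> r" "r < (1::real)"
  shows "summable (\<lambda>l. real ((k + l) choose l) * r ^ l)"
proof (induction k)
  case 0
  show ?case using assms by (simp add: summable_geometric)
next
  case (Suc k)
  have "summable (\<lambda>q. \<Sum>l\<le>q. (real ((k + l) choose l) * r ^ l) * r ^ (q - l))"
    by (rule summable_Cauchy_product) (use Suc assms in \<open>auto simp: summable_geometric\<close>)
  also have "(\<lambda>q. \<Sum>l\<le>q. (real ((k + l) choose l) * r ^ l) * r ^ (q - l))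
      = (\<lambda>q. real ((Suc k + q) choose q) * r ^ q)"
  proof
    fix q
    have "(\<Sum>l\<le>q. (real ((k + l) choose l) * r ^ l) * r ^ (q - l)) = (\<Sum>l\<le>q. real ((k + l) choose l) * r ^ q)"
      by (rule sum.cong) (auto simp: mult.assoc power_add[symmetric])
    also have "\<dots> = real (\<Sum>l\<le>q. (k + l) choose l) * r ^ q"
      by (simp add: sum_distrib_right)
    finally show "(\<Sum>l\<le>q. (real ((k + l) choose l) * r ^ l) * r ^ (q - l)) = real ((Suc k + q) choose q) * r ^ q"
      by (simp only: sum_choose_lower add_Suc)
  qed
  finally show ?case .
qed

section \<open>Pure hypercontractions\<close>

locale pure_hypercontraction =
  fixes m n :: nat and T Ts :: "nat \<Rightarrow> 'h::chilbert_space \<Rightarrow> 'h"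
  assumes m_pos: "1 \<le> m"
    and Ts_adj: "\<And>i. i < n \<Longrightarrow> is_adjoint (T i) (Ts i)"
    and T_comm: "\<And>i j. i < n \<Longrightarrow> j < n \<Longrightarrow> T i \<circ> T j = T j \<circ> T i"
    and T_hyp: "m_hypercontraction m n T Ts"
    and T_pure: "pure_tuple n T Ts"
begin

lemma cinner_T: "i < n \<Longrightarrow> cinner (T i x) y = cinner x (Ts i y)"
  using Ts_adj by (simp add: is_adjoint_def)

lemma Ts_clinear: "i < n \<Longrightarrow> clinear (Ts i)"
  using Ts_adj is_adjoint_clinear by blast

lemma Ts_commuting: "commuting n Ts"
  unfolding commuting_def
proof (intro allI impI)
  fix i j u assume ij: "i < n" "j < n"
  show "Ts i (Ts j u) = Ts j (Ts i u)"
  proof (rule cinner_eq_rightI)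
    fix x
    show "cinner x (Ts i (Ts j u)) = cinner x (Ts j (Ts i u))"
      using ij fun_cong[OF T_comm[OF ij], of x] by (simp add: cinner_T[symmetric])
  qed
qed

section \<open>Sesquilinear and quadratic forms of the defect operators\<close>

definition dform :: "nat \<Rightarrow> 'h \<Rightarrow> 'h \<Rightarrow> complex" where
  "dform k u v = cinner (DeltaT n T Ts k u) v"

lemma dform_0: "dform 0 u v = cinner u v"
  by (simp add: dform_def DeltaT_def)

text \<open>Moving each \<open>T i\<close> to the other side as its adjoint leaves a recursion in
  \<open>Ts\<close> alone, from which the algebra of these forms follows by induction.\<close>

lemma dform_Suc: "dform (Suc k) u v = dform k u v - (\<Sum>i<n. dform k (Ts i u) (Ts i v))"
  by (simp add: dform_def DeltaT_def sigmaT_def cinner_diff_left cinner_sum_left cinner_T)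

lemma dform_commute: "dform k v u = cnj (dform k u v)"
proof (induction k arbitrary: u v)
  case 0
  show ?case by (simp add: dform_0 cinner_commute[of v u])
next
  case (Suc k)
  show ?case by (simp add: dform_Suc Suc[of v u] Suc[of "Ts _ v"])
qed

lemma dform_add_left: "dform k (u + u') v = dform k u v + dform k u' v"
  by (induction k arbitrary: u u' v)
    (simp_all add: dform_0 dform_Suc cinner_add_left clinear_add[OF Ts_clinear] sum.distrib)

lemma dform_scaleC_left: "dform k (scaleC a u) v = a * dform k u v"
  by (induction k arbitrary: u v)
    (simp_all add: dform_0 dform_Suc cinner_scaleC_left clinear_scaleC[OF Ts_clinear] sum_distrib_left
      right_diff_distrib)

lemma dform_add_right: "dform k u (v + v') = dform k u v + dform k u v'"
  by (metis dform_commute dform_add_left complex_cnj_add)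

lemma dform_scaleC_right: "dform k u (scaleC a v) = cnj a * dform k u v"
  by (metis dform_commute dform_scaleC_left complex_cnj_mult)

definition qform :: "nat \<Rightarrow> 'h \<Rightarrow> real" where
  "qform k u = Re (dform k u u)"

lemma dform_self: "dform k u u = complex_of_real (qform k u)"
  using arg_cong[OF dform_commute[of k u u], of Im] by (simp add: qform_def complex_eq_iff)

text \<open>All four arguments have the shape \<open>u + scaleC a v\<close>, so one summation
  statement with parameter \<open>a\<close> covers every term.\<close>

lemma dform_polarization:
  "dform k u v = (complex_of_real (qform k (u + scaleC 1 v)) - qform k (u + scaleC (-1) v)
     + \<i> * qform k (u + scaleC \<i> v) - \<i> * qform k (u + scaleC (- \<i>) v)) / 4"
  unfolding dform_self[symmetric] dform_add_left dform_add_right dform_scaleC_left dform_scaleC_right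
  by (simp add: algebra_simps)

lemma qform_0: "qform 0 u = (norm u)\<^sup>2"
  by (simp add: qform_def dform_0 cinner_self)

lemma qform_Suc: "qform (Suc k) u = qform k u - wsum n Ts (qform k) u"
  by (simp add: qform_def dform_Suc wsum_def)

lemma wsum_qform_Suc:
  "(wsum n Ts ^^ l) (qform (Suc k)) u = (wsum n Ts ^^ l) (qform k) u - (wsum n Ts ^^ Suc l) (qform k) u"
  unfolding qform_Suc[abs_def] wsum_funpow_diff by (simp add: funpow_swap1)

text \<open>Translates purity, a statement on operators, into one on iterates of
  \<open>wsum\<close>.\<close>

lemma cinner_sigmaT_funpow:
  "Re (cinner (((sigmaT n T Ts ^^ l) id) u) u) = (wsum n Ts ^^ l) (qform 0) u"
proof -
  have step: "cinner (((sigmaT n T Ts ^^ Suc l) id) u) v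
      = (\<Sum>i<n. cinner (((sigmaT n T Ts ^^ l) id) (Ts i u)) (Ts i v))" for l u v
    by (simp add: sigmaT_def cinner_sum_left cinner_T)
  show ?thesis
  proof (induction l arbitrary: u)
    case 0
    show ?case by (simp add: qform_0 cinner_self)
  next
    case (Suc l)
    then show ?case by (simp only: step wsum_funpow_Suc Re_sum)
  qed
qed

text \<open>Purity is the case \<open>k = 0\<close>; raising \<open>k\<close> forms the difference
  of a null sequence and its shift.\<close>

lemma wsum_qform_tendsto: "(\<lambda>l. (wsum n Ts ^^ l) (qform k) u) \<longlonglongrightarrow> 0"
proof (induction k)
  case 0
  have "(\<lambda>l. ((sigmaT n T Ts ^^ l) id) u) \<longlonglongrightarrow> 0"
    using T_pure by (simp add: pure_tuple_def)
  then have "(\<lambda>l. Re (cinner (((sigmaT n T Ts ^^ l) id) u) u)) \<longlonglongrightarrow> Re (cinner 0 u)"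
    by (intro tendsto_Re bounded_linear.tendsto[OF bounded_linear_cinner_left])
  then show ?case by (simp add: cinner_sigmaT_funpow)
next
  case (Suc k)
  show ?case
    unfolding wsum_qform_Suc using tendsto_diff[OF Suc LIMSEQ_Suc[OF Suc]] by simp
qed

text \<open>The series telescopes and the limit term vanishes. Formally this inverts 1 - sigma_T on
  the defect forms.\<close>

lemma qform_sums: "(\<lambda>l. (wsum n Ts ^^ l) (qform (Suc k)) u) sums qform k u"
  using telescope_sums'[OF wsum_qform_tendsto[of k u]] by (simp add: wsum_qform_Suc)

text \<open>Downward induction from \<open>m\<close>, where positivity is assumed: each step writes
  the form as a series of nonnegative terms.\<close>

lemma qform_nonneg: "k \<le> m \<Longrightarrow> 0 \<le> qform k u"
proof (induction k arbitrary: u rule: inc_induct)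
  case base
  show ?case using T_hyp by (simp add: m_hypercontraction_def pos_op_def qform_def dform_def)
next
  case (step k)
  show ?case
    by (rule sums_le[OF _ sums_zero qform_sums]) (auto intro: wsum_funpow_nonneg step)
qed

lemma row_contraction: "(\<Sum>i<n. (norm (Ts i u))\<^sup>2) \<le> (norm u)\<^sup>2"
proof -
  have "0 \<le> qform 1 u"
    using T_hyp by (simp add: m_hypercontraction_def pos_op_def qform_def dform_def)
  then show ?thesis using qform_Suc[of 0 u] by (simp add: wsum_def qform_0)
qed

lemma has_sum_rho_qform:
  assumes "1 \<le> k" "k \<le> m"
  shows "((\<lambda>\<alpha>. rho k n \<alpha> * qform m (opmpow n Ts \<alpha> u)) has_sum qform (m - k) u) (multi_idx n)"
proof -
  obtain k' where k: "k = Suc k'" using assms by (cases k) auto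
  \<comment> \<open>The chain \<open>qform (m - j)\<close> runs downwards from \<open>m\<close>;
    \<open>m - 0\<close> is kept so that the statement matches its member with
    \<open>j = 0\<close>.\<close>
  have "(\<lambda>l. real ((k' + l) choose l) * (wsum n Ts ^^ l) (qform (m - 0)) u) sums qform (m - Suc k') u"
  proof (rule sums_binomial_wsum[of k' "\<lambda>j. qform (m - j)"])
    fix j u assume "j \<le> k'"
    then have "m - j = Suc (m - Suc j)" using assms k by simp
    then show "(\<lambda>l. (wsum n Ts ^^ l) (qform (m - j)) u) sums qform (m - Suc j) u"
      using qform_sums by metis
  qed (simp add: qform_nonneg)
  then show ?thesis
    unfolding k by (intro has_sum_rho_opmpow[OF Ts_commuting]) (auto simp: qform_nonneg)
qed

lemma opmpow_Ts_clinear: "clinear (opmpow n Ts \<alpha>)"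
  by (rule opmpow_clinear) (rule Ts_clinear)

text \<open>Polarization of \<open>has_sum_rho_qform\<close>, possible since
  \<open>opmpow n Ts \<alpha>\<close> is linear.\<close>

lemma has_sum_rho_dform:
  assumes "1 \<le> k" "k \<le> m"
  shows "((\<lambda>\<alpha>. complex_of_real (rho k n \<alpha>) * dform m (opmpow n Ts \<alpha> u) (opmpow n Ts \<alpha> v))
    has_sum dform (m - k) u v) (multi_idx n)"
proof -
  have q: "((\<lambda>\<alpha>. complex_of_real (rho k n \<alpha>) * complex_of_real (qform m (opmpow n Ts \<alpha> u + scaleC a (opmpow n Ts \<alpha> v))))
      has_sum complex_of_real (qform (m - k) (u + scaleC a v))) (multi_idx n)" for a
    using has_sum_of_real[OF has_sum_rho_qform[OF assms, of "u + scaleC a v"]]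
    by (simp add: clinear_add[OF opmpow_Ts_clinear] clinear_scaleC[OF opmpow_Ts_clinear])
  have "((\<lambda>\<alpha>. (1/4) * ((complex_of_real (rho k n \<alpha>) * complex_of_real (qform m (opmpow n Ts \<alpha> u + scaleC 1 (opmpow n Ts \<alpha> v)))
      - complex_of_real (rho k n \<alpha>) * complex_of_real (qform m (opmpow n Ts \<alpha> u + scaleC (-1) (opmpow n Ts \<alpha> v))))
      + \<i> * (complex_of_real (rho k n \<alpha>) * complex_of_real (qform m (opmpow n Ts \<alpha> u + scaleC \<i> (opmpow n Ts \<alpha> v))))
      - \<i> * (complex_of_real (rho k n \<alpha>) * complex_of_real (qform m (opmpow n Ts \<alpha> u + scaleC (-\<i>) (opmpow n Ts \<alpha> v))))))
    has_sum (1/4) * ((complex_of_real (qform (m - k) (u + scaleC 1 v)) - qform (m - k) (u + scaleC (-1) v))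
     + \<i> * qform (m - k) (u + scaleC \<i> v) - \<i> * qform (m - k) (u + scaleC (- \<i>) v))) (multi_idx n)"
    by (intro has_sum_cmult_right has_sum_add has_sum_diff q)
  then show ?thesis
    unfolding dform_polarization by (simp add: field_simps)
qed

section \<open>The powers of the resolvent as power series in \<open>z\<close>\<close>

definition zrad :: "(nat \<Rightarrow> complex) \<Rightarrow> real" where
  "zrad z = sqrt (\<Sum>i<n. (cmod (z i))\<^sup>2)"

lemma zrad_nonneg: "0 \<le> zrad z"
  by (simp add: zrad_def sum_nonneg)

lemma zrad_less_1: "z \<in> ballN n \<Longrightarrow> zrad z < 1"
  by (simp add: zrad_def ballN_def)

text \<open>The Cauchy-Schwarz inequality in C^n together with
  \<open>row_contraction\<close>.\<close>

lemma sum_norm_scaleC_Ts_le: "(\<Sum>i<n. norm (scaleC (z i) (Ts i u))) \<le> zrad z * norm u"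
proof -
  have "(\<Sum>i<n. norm (scaleC (z i) (Ts i u))) = (\<Sum>i<n. \<bar>cmod (z i)\<bar> * \<bar>norm (Ts i u)\<bar>)" by simp
  also have "\<dots> \<le> L2_set (\<lambda>i. cmod (z i)) {..<n} * L2_set (\<lambda>i. norm (Ts i u)) {..<n}"
    by (rule L2_set_mult_ineq)
  also have "\<dots> \<le> zrad z * norm u"
    unfolding zrad_def L2_set_def
    by (intro mult_left_mono real_sqrt_ge_zero sum_nonneg) (use row_contraction[of u] in \<open>auto intro: real_le_lsqrt\<close>)
  finally show ?thesis .
qed

lemma wsum_norm_le:
  "(wsum n (\<lambda>i u. scaleC (z i) (Ts i u)) ^^ l) norm u \<le> zrad z ^ l * norm u"
proof (induction l arbitrary: u)
  case (Suc l)
  have "(wsum n (\<lambda>i u. scaleC (z i) (Ts i u)) ^^ Suc l) norm u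
      \<le> (\<Sum>i<n. zrad z ^ l * norm (scaleC (z i) (Ts i u)))"
    unfolding wsum_funpow_Suc by (intro sum_mono Suc)
  also have "\<dots> \<le> zrad z ^ l * (zrad z * norm u)"
    unfolding sum_distrib_left[symmetric]
    by (intro mult_left_mono sum_norm_scaleC_Ts_le zero_le_power zrad_nonneg)
  finally show ?case by (simp add: mult_ac)
qed simp

lemma commuting_scaleC_Ts: "commuting n (\<lambda>i u. scaleC (z i) (Ts i u))"
  using Ts_commuting
  by (simp add: commuting_def clinear_scaleC[OF Ts_clinear] scaleC_scaleC mult.commute)

text \<open>Words of length \<open>l\<close> contribute at most \<open>zrad z ^ l * norm u\<close>
  in norm altogether, and \<open>zrad z < 1\<close>. So a binomial series dominates, with
  \<open>norm\<close> in the role of \<open>F\<close>.\<close>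

lemma summable_resolvent_series:
  assumes z: "z \<in> ballN n" and k: "1 \<le> k"
  shows "(\<lambda>\<alpha>. scaleC (complex_of_real (rho k n \<alpha>) * mpow n z \<alpha>) (opmpow n Ts \<alpha> u)) summable_on multi_idx n"
proof -
  obtain k' where k': "k = Suc k'" using k by (cases k) auto
  let ?S = "\<lambda>i u. scaleC (z i) (Ts i u)"
  have "summable (\<lambda>l. real ((k' + l) choose l) * (wsum n ?S ^^ l) norm u)"
  proof (rule summable_comparison_test')
    show "summable (\<lambda>l. (real ((k' + l) choose l) * zrad z ^ l) * norm u)"
      by (intro summable_mult2 summable_binomial_power zrad_nonneg zrad_less_1 z)
    show "norm (real ((k' + l) choose l) * (wsum n ?S ^^ l) norm u)
        \<le> (real ((k' + l) choose l) * zrad z ^ l) * norm u" for l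
      using wsum_norm_le[where z = z and l = l and u = u] wsum_funpow_nonneg[where F = norm and n = n and S = ?S and l = l and u = u]
      by (simp add: abs_mult mult.assoc mult_left_mono)
  qed
  then have "(\<lambda>\<alpha>. rho k n \<alpha> * norm (opmpow n ?S \<alpha> u)) summable_on multi_idx n"
    unfolding k' summable_on_def summable_def
    using has_sum_rho_opmpow[OF commuting_scaleC_Ts, of norm] norm_ge_zero by blast
  then have "(\<lambda>\<alpha>. norm (scaleC (complex_of_real (rho k n \<alpha>) * mpow n z \<alpha>) (opmpow n Ts \<alpha> u))) summable_on multi_idx n"
    by (simp add: opmpow_scaleC[OF Ts_clinear] norm_mult mult.assoc abs_of_pos[OF rho_pos])
  then show ?thesis by (rule abs_summable_summable)
qed

definition Rz :: "nat \<Rightarrow> (nat \<Rightarrow> complex) \<Rightarrow> 'h \<Rightarrow> 'h" where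
  "Rz k z u = (\<Sum>\<^sub>\<infinity>\<alpha>\<in>multi_idx n.
     scaleC (complex_of_real (rho k n \<alpha>) * mpow n z \<alpha>) (opmpow n Ts \<alpha> u))"

lemma has_sum_Rz:
  assumes "z \<in> ballN n" "1 \<le> k"
  shows "((\<lambda>\<alpha>. scaleC (complex_of_real (rho k n \<alpha>) * mpow n z \<alpha>) (opmpow n Ts \<alpha> u)) has_sum Rz k z u) (multi_idx n)"
  unfolding Rz_def by (rule has_sum_infsum[OF summable_resolvent_series[OF assms]])

lemma has_sum_Rz_nonzero:
  assumes "z \<in> ballN n" "1 \<le> k"
  shows "((\<lambda>\<alpha>. scaleC (complex_of_real (rho k n \<alpha>) * mpow n z \<alpha>) (opmpow n Ts \<alpha> u)) has_sum (Rz k z u - u))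
    {\<alpha> \<in> multi_idx n. \<alpha> \<noteq> (\<lambda>_. 0)}"
proof -
  have "{\<alpha> \<in> multi_idx n. \<alpha> \<noteq> (\<lambda>_. 0)} = multi_idx n - {\<lambda>_. 0}" by auto
  then show ?thesis
    using has_sum_Diff[OF has_sum_Rz[OF assms, of u] has_sum_finite[of "{\<lambda>_. 0}"]] assms
    by (simp add: rho_zero opmpow_zero scaleC_one)
qed

text \<open>\<open>ZTs\<close> moves the term at \<open>\<alpha>\<close> to
  \<open>inc i \<alpha>\<close>; the coefficient at \<open>\<beta>\<close> collects all possible
  \<open>i\<close>.\<close>

lemma has_sum_ZTs_Rz:
  assumes z: "z \<in> ballN n"
  shows "((\<lambda>\<beta>. scaleC (complex_of_real (\<Sum>i | i < n \<and> 0 < \<beta> i. rho (Suc k) n (dec i \<beta>)) * mpow n z \<beta>) (opmpow n Ts \<beta> u))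
    has_sum ZTs n z Ts (Rz (Suc k) z u)) {\<beta> \<in> multi_idx n. \<beta> \<noteq> (\<lambda>_. 0)}"
proof -
  define G where "G i \<alpha> = scaleC (complex_of_real (rho (Suc k) n \<alpha>) * mpow n z (inc i \<alpha>)) (opmpow n Ts (inc i \<alpha>) u)" for i \<alpha>
  have G: "(G i has_sum scaleC (z i) (Ts i (Rz (Suc k) z u))) {\<alpha> \<in> multi_idx n. True}" if i: "i < n" for i
  proof -
    have "norm (Ts i v) \<le> 1 * norm v" for v
    proof -
      have "(norm (Ts i v))\<^sup>2 \<le> (\<Sum>i<n. (norm (Ts i v))\<^sup>2)"
        using i by (intro member_le_sum) auto
      also have "\<dots> \<le> (norm v)\<^sup>2" by (rule row_contraction)
      finally show ?thesis by simp
    qed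
    then have bl: "bounded_linear (Ts i)" by (rule clinear_bounded_linear[OF Ts_clinear[OF i]])
    have "Ts i (opmpow n Ts \<alpha> u) = opmpow n Ts (inc i \<alpha>) u" for \<alpha>
      using opmpow_inc[OF Ts_commuting i] opmpow_commute[of n Ts "Ts i" \<alpha> u] Ts_commuting i
      by (simp add: commuting_def)
    then show ?thesis
      using has_sum_scaleC[OF has_sum_bounded_linear[OF bl has_sum_Rz[OF z, of "Suc k" u]], of "z i"] i
      by (simp add: G_def[abs_def] o_def clinear_scaleC[OF Ts_clinear] scaleC_scaleC mpow_inc mult_ac)
  qed
  have "(\<Sum>i | i < n \<and> 0 < \<beta> i. G i (dec i \<beta>))
      = scaleC (complex_of_real (\<Sum>i | i < n \<and> 0 < \<beta> i. rho (Suc k) n (dec i \<beta>)) * mpow n z \<beta>) (opmpow n Ts \<beta> u)" for \<beta>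
    by (simp add: G_def inc_dec sum_distrib_right scaleC_sum_left)
  then show ?thesis
    using has_sum_shift_multi_idx[where P = "\<lambda>_. True" and G = G, OF G] by (simp add: ZTs_def)
qed

text \<open>Coefficients are compared away from the zero index by the recurrences for
  \<open>rho\<close>; the degree 0 term is \<open>u\<close> on both sides and is split off. For
  \<open>k = 0\<close> everything of positive degree cancels.\<close>

lemma Rz_resolvent:
  assumes z: "z \<in> ballN n"
  shows "Rz (Suc k) z u - ZTs n z Ts (Rz (Suc k) z u) = (if k = 0 then u else Rz k z u)"
proof -
  let ?A = "{\<beta> \<in> multi_idx n. \<beta> \<noteq> (\<lambda>_. 0)}"
  define c where "c \<beta> = complex_of_real (rho (Suc k) n \<beta> - (\<Sum>i | i < n \<and> 0 < \<beta> i. rho (Suc k) n (dec i \<beta>)))" for \<beta>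
  have "((\<lambda>\<beta>. scaleC (c \<beta> * mpow n z \<beta>) (opmpow n Ts \<beta> u)) has_sum
      (Rz (Suc k) z u - u - ZTs n z Ts (Rz (Suc k) z u))) ?A"
    using has_sum_diff[OF has_sum_Rz_nonzero[OF z, of "Suc k" u] has_sum_ZTs_Rz[OF z, of k u]]
    by (simp add: c_def scaleC_diff_left left_diff_distrib)
  moreover have "((\<lambda>\<beta>. scaleC (c \<beta> * mpow n z \<beta>) (opmpow n Ts \<beta> u)) has_sum
      ((if k = 0 then u else Rz k z u) - u)) ?A"
  proof (cases "k = 0")
    case True
    have "c \<beta> = 0" if "\<beta> \<in> ?A" for \<beta>
      using rho_1_recurrence[of n \<beta>] mdeg_pos[of \<beta> n] that True by (simp add: c_def)
    then show ?thesis using True by (auto intro: has_sum_0)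
  next
    case False
    have "c \<beta> = complex_of_real (rho k n \<beta>)" if "\<beta> \<in> ?A" for \<beta>
      using rho_Suc_recurrence[of n \<beta> k] mdeg_pos[of \<beta> n] that False by (simp add: c_def)
    then have "((\<lambda>\<beta>. scaleC (c \<beta> * mpow n z \<beta>) (opmpow n Ts \<beta> u)) has_sum (Rz k z u - u)) ?A"
      using False has_sum_Rz_nonzero[OF z, of k u] by (subst has_sum_cong) auto
    then show ?thesis using False by simp
  qed
  ultimately have "Rz (Suc k) z u - u - ZTs n z Ts (Rz (Suc k) z u) = (if k = 0 then u else Rz k z u) - u"
    by (rule has_sum_unique)
  then show ?thesis by (simp add: algebra_simps split: if_splits)
qed

lemma norm_ZTs_le: "norm (ZTs n z Ts u) \<le> zrad z * norm u"
  unfolding ZTs_def by (rule order_trans[OF norm_sum sum_norm_scaleC_Ts_le])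

lemma ZTs_clinear: "clinear (ZTs n z Ts)"
  by (simp add: clinear_def ZTs_def scaleC_add_right scaleC_scaleC scaleC_sum_right sum.distrib
      clinear_add[OF Ts_clinear] clinear_scaleC[OF Ts_clinear] mult.commute)

lemma norm_resolvent_ge: "(1 - zrad z) * norm h \<le> norm (h - ZTs n z Ts h)"
  using norm_ZTs_le[of z h] norm_triangle_ineq2[of h "ZTs n z Ts h"] by (simp add: left_diff_distrib)

lemma resolvent_clinear: "clinear (\<lambda>h. h - ZTs n z Ts h)"
  using ZTs_clinear[of z] by (simp add: clinear_def scaleC_diff_right)

text \<open>\<open>Wtf\<close> is built with the choice-based \<open>inv\<close>; injectivity makes
  it return the solutions provided by \<open>Rz\<close>.\<close>

lemma resolvent_inj:
  assumes z: "z \<in> ballN n"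
  shows "inj (\<lambda>h. h - ZTs n z Ts h)"
proof (rule injI)
  fix x y assume "x - ZTs n z Ts x = y - ZTs n z Ts y"
  moreover have "(x - y) - ZTs n z Ts (x - y) = (x - ZTs n z Ts x) - (y - ZTs n z Ts y)"
    using clinear_add[OF resolvent_clinear[of z], of "x - y" y] by (simp add: algebra_simps)
  ultimately have "norm ((x - y) - ZTs n z Ts (x - y)) = 0" by simp
  then have "(1 - zrad z) * norm (x - y) \<le> 0" using norm_resolvent_ge[of z "x - y"] by simp
  then show "x = y" using zrad_less_1[OF z] by (simp add: mult_le_0_iff)
qed

lemma inv_resolvent_funpow:
  assumes z: "z \<in> ballN n"
  shows "(inv (\<lambda>h. h - ZTs n z Ts h) ^^ Suc k) u = Rz (Suc k) z u"
proof -
  have *: "inv (\<lambda>h. h - ZTs n z Ts h) x = y" if "y - ZTs n z Ts y = x" for x y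
    using that inv_f_eq[OF resolvent_inj[OF z]] by blast
  show ?thesis
  proof (induction k)
    case 0
    show ?case using Rz_resolvent[OF z, of 0 u] by (simp add: *)
  next
    case (Suc k)
    have "(inv (\<lambda>h. h - ZTs n z Ts h) ^^ Suc (Suc k)) u = inv (\<lambda>h. h - ZTs n z Ts h) (Rz (Suc k) z u)"
      using Suc by simp
    then show ?case using Rz_resolvent[OF z, of "Suc k" u] by (simp add: *)
  qed
qed

lemma inv_resolvent:
  assumes z: "z \<in> ballN n"
  shows "clinear (inv (\<lambda>h. h - ZTs n z Ts h))"
    and "norm (inv (\<lambda>h. h - ZTs n z Ts h) u) \<le> 1 / (1 - zrad z) * norm u"
proof -
  let ?L = "\<lambda>h. h - ZTs n z Ts h"
  \<comment> \<open>Surjectivity comes from the series: \<open>Rz (Suc 0) z u\<close> is a preimage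
    of \<open>u\<close>.\<close>
  have right: "?L (inv ?L u) = u" for u
    using inv_resolvent_funpow[OF z, of 0 u] Rz_resolvent[OF z, of 0 u] by simp
  show "clinear (inv ?L)"
    unfolding clinear_def
  proof (intro conjI allI)
    fix x y a
    show "inv ?L (x + y) = inv ?L x + inv ?L y"
      by (rule injD[OF resolvent_inj[OF z]]) (simp only: right clinear_add[OF resolvent_clinear])
    show "inv ?L (scaleC a x) = scaleC a (inv ?L x)"
      by (rule injD[OF resolvent_inj[OF z]]) (simp only: right clinear_scaleC[OF resolvent_clinear])
  qed
  show "norm (inv ?L u) \<le> 1 / (1 - zrad z) * norm u"
    using norm_resolvent_ge[of z "inv ?L u"] zrad_less_1[OF z] unfolding right
    by (simp add: field_simps)
qed

end

section \<open>Inner products in the spaces \<open>H\<^sub>m\<close>\<close>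

lemma Hm_rep_monomial:
  assumes "\<alpha> \<in> multi_idx n"
  shows "Hm_rep n (\<lambda>\<beta>. if \<beta> = \<alpha> then x else 0) (\<lambda>z. scaleC (mpow n z \<alpha>) x)"
  unfolding Hm_rep_def
  by (intro ballI has_sum_finite_neutralI[where B = "{\<alpha>}"]) (use assms in auto)

lemma in_Hm_monomial:
  assumes "\<alpha> \<in> multi_idx n"
  shows "in_Hm m n (\<lambda>z. scaleC (mpow n z \<alpha>) x)"
  unfolding in_Hm_def
proof (intro exI conjI)
  show "Hm_rep n (\<lambda>\<beta>. if \<beta> = \<alpha> then x else 0) (\<lambda>z. scaleC (mpow n z \<alpha>) x)"
    by (rule Hm_rep_monomial[OF assms])
  have "((\<lambda>\<beta>. (norm (if \<beta> = \<alpha> then x else 0))\<^sup>2 / rho m n \<beta>) has_sum (norm x)\<^sup>2 / rho m n \<alpha>) (multi_idx n)"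
    by (rule has_sum_finite_neutralI[where B = "{\<alpha>}"]) (use assms in auto)
  then show "(\<lambda>\<beta>. (norm (if \<beta> = \<alpha> then x else 0))\<^sup>2 / rho m n \<beta>) summable_on multi_idx n"
    by (rule has_sum_imp_summable)
qed

lemma Hm_inner_monomial:
  assumes "Hm_rep n c f" "\<alpha> \<in> multi_idx n"
  shows "Hm_inner m n f (\<lambda>z. scaleC (mpow n z \<alpha>) x) = cinner (c \<alpha>) x / complex_of_real (rho m n \<alpha>)"
proof -
  have "((\<lambda>\<beta>. cinner (c \<beta>) (if \<beta> = \<alpha> then x else 0) / complex_of_real (rho m n \<beta>)) has_sum
      cinner (c \<alpha>) x / complex_of_real (rho m n \<alpha>)) (multi_idx n)"
    by (rule has_sum_finite_neutralI[where B = "{\<alpha>}"]) (use assms in auto)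
  then show ?thesis
    unfolding Hm_inner_eq[OF assms(1) Hm_rep_monomial[OF assms(2)]] by (rule infsumI)
qed

lemma bij_betw_multi_idx_add:
  assumes "\<alpha> \<in> multi_idx n"
  shows "bij_betw (\<lambda>\<gamma> i. \<alpha> i + \<gamma> i) (multi_idx n) {\<beta> \<in> multi_idx n. \<forall>i. \<alpha> i \<le> \<beta> i}"
  by (rule bij_betwI[where g = "\<lambda>\<beta> i. \<beta> i - \<alpha> i"]) (use assms in \<open>auto simp: multi_idx_def\<close>)

text \<open>Multiplication by the monomial shifts coefficients by \<open>\<alpha>\<close>; the guard
  excludes indices where subtraction would truncate.\<close>

lemma Hm_rep_mpow_mult:
  assumes c: "Hm_rep n c f" and \<alpha>: "\<alpha> \<in> multi_idx n"
  shows "Hm_rep n (\<lambda>\<beta>. if \<forall>i. \<alpha> i \<le> \<beta> i then c (\<lambda>i. \<beta> i - \<alpha> i) else 0) (\<lambda>z. scaleC (mpow n z \<alpha>) (f z))"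
  unfolding Hm_rep_def
proof
  fix z assume "z \<in> ballN n"
  then have "((\<lambda>\<gamma>. scaleC (mpow n z \<alpha>) (scaleC (mpow n z \<gamma>) (c \<gamma>))) has_sum scaleC (mpow n z \<alpha>) (f z)) (multi_idx n)"
    using c by (intro has_sum_scaleC) (simp add: Hm_rep_def)
  then have "((\<lambda>\<gamma>. (\<lambda>\<beta>. scaleC (mpow n z \<beta>) (c (\<lambda>i. \<beta> i - \<alpha> i))) (\<lambda>i. \<alpha> i + \<gamma> i)) has_sum scaleC (mpow n z \<alpha>) (f z)) (multi_idx n)"
    by (simp add: scaleC_scaleC mpow_add)
  then have "((\<lambda>\<beta>. scaleC (mpow n z \<beta>) (c (\<lambda>i. \<beta> i - \<alpha> i))) has_sum scaleC (mpow n z \<alpha>) (f z)) {\<beta> \<in> multi_idx n. \<forall>i. \<alpha> i \<le> \<beta> i}"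
    using has_sum_reindex_bij_betw[OF bij_betw_multi_idx_add[OF \<alpha>]] by blast
  then show "((\<lambda>\<beta>. scaleC (mpow n z \<beta>) (if \<forall>i. \<alpha> i \<le> \<beta> i then c (\<lambda>i. \<beta> i - \<alpha> i) else 0))
      has_sum scaleC (mpow n z \<alpha>) (f z)) (multi_idx n)"
    by (rule has_sum_cong_neutral[THEN iffD1, rotated -1]) auto
qed

lemma Hm_inner_mpow_mult:
  assumes c: "Hm_rep n c f" and d: "Hm_rep n d g" and \<alpha>: "\<alpha> \<in> multi_idx n"
    and sum: "((\<lambda>\<gamma>. cinner (c (\<lambda>i. \<alpha> i + \<gamma> i)) (d \<gamma>) / complex_of_real (rho m n (\<lambda>i. \<alpha> i + \<gamma> i))) has_sum s) (multi_idx n)"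
  shows "Hm_inner m n f (\<lambda>z. scaleC (mpow n z \<alpha>) (g z)) = s"
proof -
  define h where "h \<beta> = cinner (c \<beta>) (d (\<lambda>i. \<beta> i - \<alpha> i)) / complex_of_real (rho m n \<beta>)" for \<beta>
  have "((\<lambda>\<gamma>. h (\<lambda>i. \<alpha> i + \<gamma> i)) has_sum s) (multi_idx n)"
    using sum by (simp add: h_def)
  then have "(h has_sum s) {\<beta> \<in> multi_idx n. \<forall>i. \<alpha> i \<le> \<beta> i}"
    using has_sum_reindex_bij_betw[OF bij_betw_multi_idx_add[OF \<alpha>], of h] by blast
  then have "((\<lambda>\<beta>. cinner (c \<beta>) (if \<forall>i. \<alpha> i \<le> \<beta> i then d (\<lambda>i. \<beta> i - \<alpha> i) else 0) / complex_of_real (rho m n \<beta>)) has_sum s) (multi_idx n)"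
    by (rule has_sum_cong_neutral[THEN iffD1, rotated -1]) (auto simp: h_def)
  then show ?thesis
    unfolding Hm_inner_eq[OF c Hm_rep_mpow_mult[OF d \<alpha>]] by (rule infsumI)
qed

section \<open>The transfer function\<close>

text \<open>(KI1) to (KI3) appear in weak form, as identities of sesquilinear forms. In (KI4) one
  \<open>f\<close> serves all \<open>i\<close>, because the whole column has to lie in the
  image.\<close>

locale K_inner_colligation = pure_hypercontraction m n T Ts
  for m n :: nat and T Ts :: "nat \<Rightarrow> 'h::chilbert_space \<Rightarrow> 'h" +
  fixes B :: "nat \<Rightarrow> 'es::chilbert_space \<Rightarrow> 'h"
    and C :: "'h \<Rightarrow> 'e::chilbert_space"
    and D :: "'es \<Rightarrow> 'e"
  assumes B_bdd: "\<And>i. i < n \<Longrightarrow> cbounded_linear (B i)"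
    and C_bdd: "cbounded_linear C"
    and D_bdd: "cbounded_linear D"
    and KI1: "\<And>h h'. cinner (C h) (C h') = cinner (DeltaT n T Ts m h) h'"
    and KI2: "\<And>h e. cinner (C h) (D e) =
               - (\<Sum>i<n. cinner (DeltaSum n T Ts m (Ts i h)) (B i e))"
    and KI3: "\<And>e e'. cinner (D e) (D e') +
               (\<Sum>i<n. cinner (DeltaSum n T Ts m (B i e)) (B i e')) = cinner e e'"
    and KI4: "\<And>e. \<exists>f. in_Hm m n f \<and> (\<forall>i<n. is_Mz_adj m n i f (jC m n C Ts (B i e)))"
begin

lemma C_clinear: "clinear C"
  using C_bdd by (simp add: cbounded_linear_def)

lemma has_sum_C: "(f has_sum s) A \<Longrightarrow> ((\<lambda>x. C (f x)) has_sum C s) A"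
  using has_sum_bounded_linear[OF cbounded_linear_bounded_linear[OF C_bdd]] by blast

lemma Hm_rep_jC:
  "Hm_rep n (\<lambda>\<alpha>. scaleC (complex_of_real (rho m n \<alpha>)) (C (opmpow n Ts \<alpha> u))) (jC m n C Ts u)"
  unfolding Hm_rep_def
proof
  fix z assume z: "z \<in> ballN n"
  let ?f = "\<lambda>\<alpha>. scaleC (complex_of_real (rho m n \<alpha>) * mpow n z \<alpha>) (C (opmpow n Ts \<alpha> u))"
  have sum: "(?f has_sum C (Rz m z u)) (multi_idx n)"
    using has_sum_C[OF has_sum_Rz[OF z m_pos, of u]] by (simp add: clinear_scaleC[OF C_clinear])
  have "jC m n C Ts u z = C (Rz m z u)"
    unfolding jC_def by (rule infsumI[OF sum])
  with sum show "((\<lambda>\<alpha>. scaleC (mpow n z \<alpha>) (scaleC (complex_of_real (rho m n \<alpha>)) (C (opmpow n Ts \<alpha> u))))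
      has_sum jC m n C Ts u z) (multi_idx n)"
    by (simp add: scaleC_scaleC mult.commute)
qed

text \<open>(KI4) read off on Taylor coefficients, by testing the adjoint relation against monomials.\<close>

lemma ex_gB:
  assumes \<beta>: "\<beta> \<in> multi_idx n"
  shows "\<exists>y. \<forall>i<n. 0 < \<beta> i \<longrightarrow> y = C (opmpow n Ts (dec i \<beta>) (B i e))"
proof -
  obtain f where f: "in_Hm m n f" and adj: "\<And>i. i < n \<Longrightarrow> is_Mz_adj m n i f (jC m n C Ts (B i e))"
    using KI4 by blast
  obtain c where c: "Hm_rep n c f" using f by (auto simp: in_Hm_def)
  have rho0: "complex_of_real (rho m n \<alpha>) \<noteq> 0" for \<alpha>
    using rho_pos[of m n \<alpha>] by simp
  show ?thesis
  proof (intro exI allI impI)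
    fix i assume i: "i < n" "0 < \<beta> i"
    have \<alpha>: "dec i \<beta> \<in> multi_idx n" using \<beta> by (rule dec_multi_idx)
    \<comment> \<open>The witness is the coefficient of \<open>f\<close> at \<open>\<beta>\<close>
      divided by its weight, which does not involve \<open>i\<close>.\<close>
    show "scaleC (1 / complex_of_real (rho m n \<beta>)) (c \<beta>) = C (opmpow n Ts (dec i \<beta>) (B i e))"
    proof (rule cinner_eq_leftI)
      fix x :: 'e
      have "cinner (C (opmpow n Ts (dec i \<beta>) (B i e))) x
          = Hm_inner m n (jC m n C Ts (B i e)) (\<lambda>z. scaleC (mpow n z (dec i \<beta>)) x)"
        unfolding Hm_inner_monomial[OF Hm_rep_jC \<alpha>] using rho0 by (simp add: cinner_scaleC_left)
      also have "\<dots> = Hm_inner m n f (\<lambda>z. scaleC (z i) (scaleC (mpow n z (dec i \<beta>)) x))"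
        using adj[OF i(1)] in_Hm_monomial[OF \<alpha>] unfolding is_Mz_adj_def by blast
      also have "(\<lambda>z. scaleC (z i) (scaleC (mpow n z (dec i \<beta>)) x)) = (\<lambda>z. scaleC (mpow n z \<beta>) x)"
        using mpow_inc[OF i(1), of _ "dec i \<beta>"] i(2) by (simp add: scaleC_scaleC inc_dec)
      also have "Hm_inner m n f \<dots> = cinner (c \<beta>) x / complex_of_real (rho m n \<beta>)"
        by (rule Hm_inner_monomial[OF c \<beta>])
      finally show "cinner (scaleC (1 / complex_of_real (rho m n \<beta>)) (c \<beta>)) x
          = cinner (C (opmpow n Ts (dec i \<beta>) (B i e))) x"
        by (simp add: cinner_scaleC_left)
    qed
  qed
qed

text \<open>The condition is vacuous at the zero index, where the value is arbitrary;
  \<open>Wcoeff\<close> treats that index separately.\<close>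

definition gB :: "'es \<Rightarrow> (nat \<Rightarrow> nat) \<Rightarrow> 'e" where
  "gB e \<beta> = (SOME y. \<forall>i<n. 0 < \<beta> i \<longrightarrow> y = C (opmpow n Ts (dec i \<beta>) (B i e)))"

lemma gB_eq:
  assumes "\<beta> \<in> multi_idx n" "i < n" "0 < \<beta> i"
  shows "gB e \<beta> = C (opmpow n Ts (dec i \<beta>) (B i e))"
  using someI_ex[OF ex_gB[OF assms(1), of e]] assms(2,3) unfolding gB_def by blast

text \<open>Splitting \<open>rho m n \<beta>\<close> spreads each term over pairs
  \<open>(i, k)\<close>, and by (KI1) the part of such a pair sums to
  \<open>dform (m - k) (v i) (v' i)\<close>. The tuples stay general because norm and orthogonality
  use different ones.\<close>

lemma has_sum_rho_cinner:
  assumes g: "\<And>\<beta> i. \<beta> \<in> multi_idx n \<Longrightarrow> i < n \<Longrightarrow> 0 < \<beta> i \<Longrightarrow> g \<beta> = C (opmpow n Ts (dec i \<beta>) (v i))"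
    and g': "\<And>\<beta> i. \<beta> \<in> multi_idx n \<Longrightarrow> i < n \<Longrightarrow> 0 < \<beta> i \<Longrightarrow> g' \<beta> = C (opmpow n Ts (dec i \<beta>) (v' i))"
  shows "((\<lambda>\<beta>. complex_of_real (rho m n \<beta>) * cinner (g \<beta>) (g' \<beta>)) has_sum
    (\<Sum>i<n. cinner (DeltaSum n T Ts m (v i)) (v' i))) {\<beta> \<in> multi_idx n. \<beta> \<noteq> (\<lambda>_. 0)}"
proof -
  define G where "G i \<alpha> = (\<Sum>k=1..m. complex_of_real (rho k n \<alpha>)
    * cinner (C (opmpow n Ts \<alpha> (v i))) (C (opmpow n Ts \<alpha> (v' i))))" for i \<alpha>
  have G: "(G i has_sum cinner (DeltaSum n T Ts m (v i)) (v' i)) {\<alpha> \<in> multi_idx n. True}" for i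
  proof -
    have "(G i has_sum (\<Sum>k=1..m. dform (m - k) (v i) (v' i))) (multi_idx n)"
      unfolding G_def[abs_def] KI1 dform_def[symmetric]
      by (intro has_sum_finite_family has_sum_rho_dform) auto
    also have "(\<Sum>k=1..m. dform (m - k) (v i) (v' i)) = (\<Sum>k<m. dform k (v i) (v' i))"
      by (rule sum.reindex_bij_witness[where i = "\<lambda>k. m - k" and j = "\<lambda>k. m - k"]) auto
    finally show ?thesis
      by (simp add: DeltaSum_def dform_def cinner_sum_left)
  qed
  have sumG: "(\<Sum>i | i < n \<and> 0 < \<beta> i. G i (dec i \<beta>)) = complex_of_real (rho m n \<beta>) * cinner (g \<beta>) (g' \<beta>)"
    if \<beta>: "\<beta> \<in> {\<beta> \<in> multi_idx n. \<beta> \<noteq> (\<lambda>_. 0)}" for \<beta>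
  proof -
    \<comment> \<open>By the assumptions on \<open>g\<close> and \<open>g'\<close> the inner
      products no longer depend on \<open>i\<close>, so only weights remain to be added.\<close>
    have "(\<Sum>i | i < n \<and> 0 < \<beta> i. G i (dec i \<beta>))
      = (\<Sum>i | i < n \<and> 0 < \<beta> i. \<Sum>k=1..m. complex_of_real (rho k n (dec i \<beta>)) * cinner (g \<beta>) (g' \<beta>))"
      using \<beta> g[of \<beta>] g'[of \<beta>] by (intro sum.cong) (auto simp: G_def)
    also have "\<dots> = complex_of_real (\<Sum>i | i < n \<and> 0 < \<beta> i. \<Sum>k=1..m. rho k n (dec i \<beta>)) * cinner (g \<beta>) (g' \<beta>)"
      by (simp add: sum_distrib_right)
    also have "(\<Sum>i | i < n \<and> 0 < \<beta> i. \<Sum>k=1..m. rho k n (dec i \<beta>)) = rho m n \<beta>"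
      using \<beta> by (intro sum_rho_dec_upto mdeg_pos m_pos) auto
    finally show ?thesis .
  qed
  have "((\<lambda>\<beta>. \<Sum>i | i < n \<and> 0 < \<beta> i. G i (dec i \<beta>)) has_sum
      (\<Sum>i<n. cinner (DeltaSum n T Ts m (v i)) (v' i))) {\<beta> \<in> multi_idx n. \<beta> \<noteq> (\<lambda>_. 0)}"
    using has_sum_shift_multi_idx[where P = "\<lambda>_. True" and G = G, OF G] by simp
  then show ?thesis by (rule has_sum_eq_on) (rule sumG)
qed

section \<open>Taylor coefficients of the transfer function\<close>

definition Wcoeff :: "'es \<Rightarrow> (nat \<Rightarrow> nat) \<Rightarrow> 'e" where
  "Wcoeff e \<beta> = (if \<beta> = (\<lambda>_. 0) then D e else scaleC (complex_of_real (rho m n \<beta>)) (gB e \<beta>))"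

lemma inv_resolvent_funpow_clinear:
  "z \<in> ballN n \<Longrightarrow> clinear (inv (\<lambda>h. h - ZTs n z Ts h) ^^ k)"
  by (rule clinear_funpow[OF inv_resolvent(1)])

lemma Wtf_eq:
  assumes z: "z \<in> ballN n"
  shows "Wtf m n Ts B C D z e = D e + (\<Sum>i<n. \<Sum>k=1..m. scaleC (z i) (C (Rz k z (B i e))))"
proof -
  have "(inv (\<lambda>h. h - ZTs n z Ts h) ^^ k) u = Rz k z u" if "k \<in> {1..m}" for k u
    using that inv_resolvent_funpow[OF z, of "k - 1" u] by simp
  then have "(\<Sum>k\<in>{1..m}. (inv (\<lambda>h. h - ZTs n z Ts h) ^^ k) (\<Sum>i<n. scaleC (z i) (B i e)))
      = (\<Sum>k\<in>{1..m}. \<Sum>i<n. scaleC (z i) (Rz k z (B i e)))"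
    by (intro sum.cong refl)
      (simp add: clinear_sum[OF inv_resolvent_funpow_clinear[OF z]] clinear_scaleC[OF inv_resolvent_funpow_clinear[OF z]])
  also have "\<dots> = (\<Sum>i<n. \<Sum>k=1..m. scaleC (z i) (Rz k z (B i e)))"
    by (rule sum.swap)
  finally show ?thesis
    by (simp add: Wtf_def clinear_sum[OF C_clinear] clinear_scaleC[OF C_clinear])
qed

text \<open>Each resolvent series, multiplied by \<open>z i\<close>, contributes at
  \<open>inc i \<alpha>\<close>. By (KI4) all contributions at one \<open>\<beta>\<close> are
  multiples of \<open>gB e \<beta>\<close>, and their weights add up to
  \<open>rho m n \<beta>\<close>.\<close>

lemma Hm_rep_Wtf: "Hm_rep n (Wcoeff e) (\<lambda>z. Wtf m n Ts B C D z e)"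
  unfolding Hm_rep_def
proof
  fix z assume z: "z \<in> ballN n"
  define G where "G i \<alpha> = (\<Sum>k=1..m. scaleC (complex_of_real (rho k n \<alpha>) * mpow n z (inc i \<alpha>))
    (C (opmpow n Ts \<alpha> (B i e))))" for i \<alpha>
  have G: "(G i has_sum (\<Sum>k=1..m. scaleC (z i) (C (Rz k z (B i e))))) {\<alpha> \<in> multi_idx n. True}"
    if i: "i < n" for i
  proof -
    have "((\<lambda>\<alpha>. scaleC (complex_of_real (rho k n \<alpha>) * mpow n z (inc i \<alpha>)) (C (opmpow n Ts \<alpha> (B i e))))
        has_sum scaleC (z i) (C (Rz k z (B i e)))) (multi_idx n)" if "k \<in> {1..m}" for k
      using has_sum_scaleC[OF has_sum_C[OF has_sum_Rz[OF z, of k "B i e"]], of "z i"] that i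
      by (simp add: clinear_scaleC[OF C_clinear] scaleC_scaleC mpow_inc mult_ac)
    then show ?thesis
      unfolding G_def[abs_def] by (auto intro: has_sum_finite_family)
  qed
  have sumG: "(\<Sum>i | i < n \<and> 0 < \<beta> i. G i (dec i \<beta>)) = scaleC (mpow n z \<beta>) (Wcoeff e \<beta>)"
    if \<beta>: "\<beta> \<in> {\<beta> \<in> multi_idx n. \<beta> \<noteq> (\<lambda>_. 0)}" for \<beta>
  proof -
    have "(\<Sum>i | i < n \<and> 0 < \<beta> i. G i (dec i \<beta>))
      = (\<Sum>i | i < n \<and> 0 < \<beta> i. \<Sum>k=1..m. scaleC (complex_of_real (rho k n (dec i \<beta>)) * mpow n z \<beta>) (gB e \<beta>))"
      using \<beta> by (intro sum.cong) (auto simp: G_def gB_eq inc_dec)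
    also have "\<dots> = scaleC (complex_of_real (\<Sum>i | i < n \<and> 0 < \<beta> i. \<Sum>k=1..m. rho k n (dec i \<beta>)) * mpow n z \<beta>) (gB e \<beta>)"
      by (simp add: scaleC_sum_left sum_distrib_right)
    also have "(\<Sum>i | i < n \<and> 0 < \<beta> i. \<Sum>k=1..m. rho k n (dec i \<beta>)) = rho m n \<beta>"
      using \<beta> by (intro sum_rho_dec_upto mdeg_pos m_pos) auto
    finally show ?thesis
      using \<beta> by (simp add: Wcoeff_def scaleC_scaleC mult.commute)
  qed
  have "((\<lambda>\<beta>. \<Sum>i | i < n \<and> 0 < \<beta> i. G i (dec i \<beta>)) has_sum
      (\<Sum>i<n. \<Sum>k=1..m. scaleC (z i) (C (Rz k z (B i e))))) {\<beta> \<in> multi_idx n. \<beta> \<noteq> (\<lambda>_. 0)}"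
    using has_sum_shift_multi_idx[where P = "\<lambda>_. True" and G = G, OF G] by simp
  then have "((\<lambda>\<beta>. scaleC (mpow n z \<beta>) (Wcoeff e \<beta>)) has_sum (\<Sum>i<n. \<Sum>k=1..m. scaleC (z i) (C (Rz k z (B i e)))))
      {\<beta> \<in> multi_idx n. \<beta> \<noteq> (\<lambda>_. 0)}"
    by (rule has_sum_eq_on) (rule sumG)
  from has_sum_multi_idxI[OF this]
  show "((\<lambda>\<beta>. scaleC (mpow n z \<beta>) (Wcoeff e \<beta>)) has_sum Wtf m n Ts B C D z e) (multi_idx n)"
    by (simp add: Wtf_eq[OF z] Wcoeff_def scaleC_one)
qed

section \<open>Isometry, orthogonality and boundedness\<close>

lemma has_sum_Wcoeff_self:
  "((\<lambda>\<beta>. cinner (Wcoeff e \<beta>) (Wcoeff e \<beta>) / complex_of_real (rho m n \<beta>)) has_sum cinner e e) (multi_idx n)"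
proof -
  have "((\<lambda>\<beta>. complex_of_real (rho m n \<beta>) * cinner (gB e \<beta>) (gB e \<beta>)) has_sum
      (\<Sum>i<n. cinner (DeltaSum n T Ts m (B i e)) (B i e))) {\<beta> \<in> multi_idx n. \<beta> \<noteq> (\<lambda>_. 0)}"
    by (rule has_sum_rho_cinner) (rule gB_eq; assumption)+
  moreover have "complex_of_real (rho m n \<beta>) * cinner (gB e \<beta>) (gB e \<beta>)
      = cinner (Wcoeff e \<beta>) (Wcoeff e \<beta>) / complex_of_real (rho m n \<beta>)" if "\<beta> \<noteq> (\<lambda>_. 0)" for \<beta>
    using that rho_pos[of m n \<beta>] by (simp add: Wcoeff_def cinner_scaleC_left cinner_scaleC_right)
  ultimately have sum: "((\<lambda>\<beta>. cinner (Wcoeff e \<beta>) (Wcoeff e \<beta>) / complex_of_real (rho m n \<beta>)) has_sum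
      (\<Sum>i<n. cinner (DeltaSum n T Ts m (B i e)) (B i e))) {\<beta> \<in> multi_idx n. \<beta> \<noteq> (\<lambda>_. 0)}"
    by (rule has_sum_eq_on) simp
  \<comment> \<open>The zero index adds \<open>cinner (D e) (D e)\<close>, which completes the left
    side of (KI3).\<close>
  from has_sum_multi_idxI[OF sum] show ?thesis
    using KI3[of e e] m_pos by (simp add: Wcoeff_def rho_zero)
qed

text \<open>Expresses that \<open>jC m n C Ts u\<close> is orthogonal to W e: the weight in the
  coefficients of \<open>jC\<close> cancels the one in the inner product. By (KI2) the zero index
  cancels all others.\<close>

lemma has_sum_C_Wcoeff:
  "((\<lambda>\<beta>. cinner (C (opmpow n Ts \<beta> u)) (Wcoeff e \<beta>)) has_sum 0) (multi_idx n)"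
proof -
  have "((\<lambda>\<beta>. complex_of_real (rho m n \<beta>) * cinner (C (opmpow n Ts \<beta> u)) (gB e \<beta>)) has_sum
      (\<Sum>i<n. cinner (DeltaSum n T Ts m (Ts i u)) (B i e))) {\<beta> \<in> multi_idx n. \<beta> \<noteq> (\<lambda>_. 0)}"
  proof (rule has_sum_rho_cinner)
    fix \<beta> :: "nat \<Rightarrow> nat" and i assume "i < n" "0 < \<beta> i"
    then show "C (opmpow n Ts \<beta> u) = C (opmpow n Ts (dec i \<beta>) (Ts i u))"
      using opmpow_inc[OF Ts_commuting, of i "dec i \<beta>" u] by (simp add: inc_dec)
  qed (rule gB_eq; assumption)
  moreover have "complex_of_real (rho m n \<beta>) * cinner (C (opmpow n Ts \<beta> u)) (gB e \<beta>)
      = cinner (C (opmpow n Ts \<beta> u)) (Wcoeff e \<beta>)" if "\<beta> \<noteq> (\<lambda>_. 0)" for \<beta>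
    using that by (simp add: Wcoeff_def cinner_scaleC_right)
  ultimately have sum: "((\<lambda>\<beta>. cinner (C (opmpow n Ts \<beta> u)) (Wcoeff e \<beta>)) has_sum
      (\<Sum>i<n. cinner (DeltaSum n T Ts m (Ts i u)) (B i e))) {\<beta> \<in> multi_idx n. \<beta> \<noteq> (\<lambda>_. 0)}"
    by (rule has_sum_eq_on) simp
  from has_sum_multi_idxI[OF sum] show ?thesis
    using KI2[of u e] by (simp add: Wcoeff_def opmpow_zero)
qed

text \<open>The adjoint of multiplication by z^alpha sends W x to \<open>jC\<close> of
  \<open>opmpow n Ts (dec i \<alpha>) (B i x)\<close>, a function orthogonal to W y. The proof
  carries this out on coefficients.\<close>

lemma Wtf_orthogonal:
  assumes \<alpha>: "\<alpha> \<in> multi_idx n" "\<alpha> \<noteq> (\<lambda>_. 0)"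
  shows "Hm_inner m n (\<lambda>z. Wtf m n Ts B C D z x) (\<lambda>z. scaleC (mpow n z \<alpha>) (Wtf m n Ts B C D z y)) = 0"
proof -
  obtain i where i: "i < n" "0 < \<alpha> i" using \<alpha> by (rule multi_idx_nonzeroE)
  have eq: "cinner (C (opmpow n Ts \<gamma> (opmpow n Ts (dec i \<alpha>) (B i x)))) (Wcoeff y \<gamma>)
      = cinner (Wcoeff x (\<lambda>i. \<alpha> i + \<gamma> i)) (Wcoeff y \<gamma>) / complex_of_real (rho m n (\<lambda>i. \<alpha> i + \<gamma> i))"
    if \<gamma>: "\<gamma> \<in> multi_idx n" for \<gamma>
  proof -
    let ?\<beta> = "\<lambda>i. \<alpha> i + \<gamma> i"
    have \<beta>: "?\<beta> \<in> multi_idx n" using \<alpha>(1) \<gamma> by (simp add: multi_idx_def)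
    have "?\<beta> i \<noteq> 0" using i by simp
    then have nz: "?\<beta> \<noteq> (\<lambda>_. 0)" by metis
    have "dec i ?\<beta> = (\<lambda>j. dec i \<alpha> j + \<gamma> j)" using i by (auto simp: dec_def)
    then have "gB x ?\<beta> = C (opmpow n Ts \<gamma> (opmpow n Ts (dec i \<alpha>) (B i x)))"
      using gB_eq[OF \<beta> i(1), of x] i opmpow_add[OF Ts_commuting, of "dec i \<alpha>" \<gamma> "B i x"] by simp
    then show ?thesis
      using nz rho_pos[of m n ?\<beta>] by (simp add: Wcoeff_def[of x] cinner_scaleC_left)
  qed
  have "((\<lambda>\<gamma>. cinner (Wcoeff x (\<lambda>i. \<alpha> i + \<gamma> i)) (Wcoeff y \<gamma>) / complex_of_real (rho m n (\<lambda>i. \<alpha> i + \<gamma> i)))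
      has_sum 0) (multi_idx n)"
    by (rule has_sum_eq_on[OF has_sum_C_Wcoeff[of "opmpow n Ts (dec i \<alpha>) (B i x)" y]]) (rule eq)
  then show ?thesis
    by (rule Hm_inner_mpow_mult[OF Hm_rep_Wtf[of x] Hm_rep_Wtf[of y] \<alpha>(1)])
qed

text \<open>\<open>bounded_linear\<close> records real linearity only, so composition yields the
  bound and complex homogeneity is checked separately.\<close>

lemma cbounded_linear_Wtf:
  assumes z: "z \<in> ballN n"
  shows "cbounded_linear (Wtf m n Ts B C D z)"
proof -
  let ?R = "inv (\<lambda>h. h - ZTs n z Ts h)"
  have bl: "bounded_linear (Wtf m n Ts B C D z)"
  proof -
    have R: "bounded_linear ?R"
      using inv_resolvent[OF z] by (rule clinear_bounded_linear)
    have Rk: "bounded_linear (?R ^^ k)" for k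
    proof (induction k)
      case (Suc k)
      then show ?case using bounded_linear_compose[OF R Suc] by (simp add: o_def)
    qed (simp add: id_def bounded_linear_ident)
    have ZB: "bounded_linear (\<lambda>e. \<Sum>i<n. scaleC (z i) (B i e))"
      using B_bdd
      by (intro bounded_linear_sum bounded_linear_compose[OF bounded_linear_scaleC] cbounded_linear_bounded_linear) auto
    have "bounded_linear (\<lambda>e. D e + C (\<Sum>k\<in>{1..m}. (?R ^^ k) (\<Sum>i<n. scaleC (z i) (B i e))))"
      by (intro bounded_linear_add cbounded_linear_bounded_linear[OF D_bdd]
          bounded_linear_compose[OF cbounded_linear_bounded_linear[OF C_bdd]] bounded_linear_sum bounded_linear_compose[OF Rk ZB])
    then show ?thesis by (simp add: Wtf_def[abs_def])
  qed
  have "Wtf m n Ts B C D z (scaleC a e) = scaleC a (Wtf m n Ts B C D z e)" for a e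
  proof -
    have D: "D (scaleC a e) = scaleC a (D e)" using D_bdd by (simp add: cbounded_linear_def clinear_scaleC)
    have B: "B i (scaleC a e) = scaleC a (B i e)" if "i < n" for i
      using B_bdd[OF that] by (simp add: cbounded_linear_def clinear_scaleC)
    have "(\<Sum>i<n. scaleC (z i) (B i (scaleC a e))) = scaleC a (\<Sum>i<n. scaleC (z i) (B i e))"
      by (simp add: B scaleC_scaleC scaleC_sum_right mult.commute)
    then show ?thesis
      by (simp add: Wtf_def D clinear_scaleC[OF inv_resolvent_funpow_clinear[OF z]]
          scaleC_sum_right[symmetric] clinear_scaleC[OF C_clinear] scaleC_add_right)
  qed
  then have "clinear (Wtf m n Ts B C D z)"
    using linear_add[OF bounded_linear.linear[OF bl]] by (simp add: clinear_def)
  then show ?thesis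
    using bounded_linear.bounded[OF bl] unfolding cbounded_linear_def by (metis mult.commute)
qed

lemma Km_inner_Wtf: "Km_inner m n (Wtf m n Ts B C D)"
  unfolding Km_inner_def
proof (intro conjI allI ballI impI)
  fix x
  have "((\<lambda>\<beta>. Re (cinner (Wcoeff x \<beta>) (Wcoeff x \<beta>) / complex_of_real (rho m n \<beta>))) has_sum Re (cinner x x)) (multi_idx n)"
    by (rule has_sum_Re[OF has_sum_Wcoeff_self])
  then have "(\<lambda>\<beta>. (norm (Wcoeff x \<beta>))\<^sup>2 / rho m n \<beta>) summable_on multi_idx n"
    unfolding cinner_self of_real_divide[symmetric] Re_complex_of_real by (rule has_sum_imp_summable)
  then show "in_Hm m n (\<lambda>z. Wtf m n Ts B C D z x)"
    unfolding in_Hm_def using Hm_rep_Wtf by blast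
  show "Hm_norm m n (\<lambda>z. Wtf m n Ts B C D z x) = norm x"
    unfolding Hm_norm_def Hm_inner_eq[OF Hm_rep_Wtf Hm_rep_Wtf] infsumI[OF has_sum_Wcoeff_self]
    by (simp add: cinner_self)
qed (fact cbounded_linear_Wtf, fact Wtf_orthogonal)

end

theorem theorem11:
  fixes m n :: nat
    and T Ts :: "nat \<Rightarrow> 'h::chilbert_space \<Rightarrow> 'h"
    and B :: "nat \<Rightarrow> 'es::chilbert_space \<Rightarrow> 'h"
    and C :: "'h \<Rightarrow> 'e::chilbert_space"
    and D :: "'es \<Rightarrow> 'e"
  assumes m_pos: "1 \<le> m"
    and T_bdd: "\<forall>i<n. cbounded_linear (T i)"
    and Ts_adj: "\<forall>i<n. is_adjoint (T i) (Ts i)"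
    and T_comm: "\<forall>i<n. \<forall>j<n. T i \<circ> T j = T j \<circ> T i"
    and T_hyp: "m_hypercontraction m n T Ts"
    and T_pure: "pure_tuple n T Ts"
    and B_bdd: "\<forall>i<n. cbounded_linear (B i)"
    and C_bdd: "cbounded_linear C"
    and D_bdd: "cbounded_linear D"
    and KI1: "\<forall>h h'. cinner (C h) (C h') = cinner (DeltaT n T Ts m h) h'"
    and KI2: "\<forall>h e. cinner (C h) (D e) =
               - (\<Sum>i<n. cinner (DeltaSum n T Ts m (Ts i h)) (B i e))"
    and KI3: "\<forall>e e'. cinner (D e) (D e') +
               (\<Sum>i<n. cinner (DeltaSum n T Ts m (B i e)) (B i e')) = cinner e e'"
    and KI4: "\<forall>e. \<exists>f. in_Hm m n f \<and> (\<forall>i<n. is_Mz_adj m n i f (jC m n C Ts (B i e)))"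
  shows "Km_inner m n (Wtf m n Ts B C D)"
proof -
  interpret K_inner_colligation m n T Ts B C D
    by unfold_locales (use assms in blast)+
  show ?thesis by (rule Km_inner_Wtf)
qed

end
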